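(* Let $E$ be a finite set, $U:E\times E\to\mathbb R$ a matrix with positive entries, and $(a_n)_{n\ge1}$ a positive sequence with partial sums $r_n=\sum_{i=1}^na_i$ satisfying $\lim_{n\to\infty}r_{n+1}/r_n=1$. Let $(X_n)$ be the vertex reinforced random walk on $E$ with $\mathsf P(X_{n+1}=y\mid\mathcal F_n)=M_n(X_n,y)$, $\mathcal F_n=\sigma(X_1,\dots,X_n)$, where $$M_n(x,y)\propto U(x,y)\Big[1+\sum_{i=1}^na_i\mathbf 1_{X_i=y}\Big]$$ (normalized so that each row sums to $1$). Assume that one of the following holds: (i) $a_i=a(i)$ where $a$ is a nondecreasing continuous function such that for all $s\in\,]0,1]$, $\lim_{t\to\infty}\frac{a(ts)}{a(t)}=1$; (ii) $a_i=a(i)$ where $a$ is a decreasing continuous function such that for all $s\in\,]0,1]$, $\lim_{t\to\infty}\frac{a(ts)}{a(t)}=1$, and there is a measurable $b:[0,1]\to\mathbb R^+$ with $\int_0^1b(s)\,ds<\infty$ and $0\le\frac{a(ts)}{a(t)}-1\le b(s)$ for all $s\in\,]0,1]$ and $t>0$. Let $v_n=\frac1n\sum_{i=1}^n\delta_{X_i}$ and, for $v\in\Delta$, let $\pi(v)$ be the (unique) invariant probability of the Markov matrix $K(\cdot,\cdot,0,v)$ with $K(x,y,0,v)\propto U(x,y)v(y)$. Then the limit set of $(v_n)$ is almost surely an internally chain transitive set of the differential equation $$\dot v=-v+\pi(v).$$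
   Context: $\Delta=\Delta(E)$ is the set of probability vectors on $E$. In (i) and (ii) $a$ is a positive function of a positive real variable. The limit set of $(v_n)$ is the set of all $p=\lim_kv_{n_k}$ with $n_k\to\infty$. A solution of the differential equation is an absolutely continuous $v:\mathbb R\to\Delta$ satisfying it for almost every $t$. For $A\subset\Delta$ and $x,y\in A$ write $x\hookrightarrow_Ay$ if for every $\varepsilon>0$, $T>0$ there are an integer $n$, solutions $\mathbf x_1,\dots,\mathbf x_n$ and reals $t_1,\dots,t_n>T$ such that $\mathbf x_i([0,t_i])\subset A$ for all $i$; $\|\mathbf x_i(t_i)-\mathbf x_{i+1}(0)\|\le\varepsilon$ for $i=1,\dots,n-1$; $\|\mathbf x_1(0)-x\|\le\varepsilon$ and $\|\mathbf x_n(t_n)-y\|\le\varepsilon$. $A$ is internally chain transitive if $A$ is compact and $x\hookrightarrow_Ay$ for all $x,y\in A$. *)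

theory Defs
  imports "HOL-Probability.Probability"
begin

section \<open>Probability vectors and Markov kernels on a finite set\<close>

text \<open>The finite set is the universe of a type of class \<^class>\<open>finite\<close>.\<close>

definition prob_vecs :: "(real ^ 'e::finite) set" where
  "prob_vecs = {v. (\<forall>x. 0 \<le> v $ x) \<and> (\<Sum>x\<in>UNIV. v $ x) = 1}"

text \<open>The matrix proportional to \<open>W\<close> whose rows sum to one. It is only used for nonnegative \<open>W\<close>
  without zero rows.\<close>

definition normalize_rows :: "real ^ 'e::finite ^ 'e \<Rightarrow> real ^ 'e ^ 'e" where
  "normalize_rows W = (\<chi> x y. W $ x $ y / (\<Sum>z\<in>UNIV. W $ x $ z))"

definition invariant_prob :: "real ^ 'e::finite ^ 'e \<Rightarrow> real ^ 'e \<Rightarrow> bool" where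
  "invariant_prob K p \<longleftrightarrow> p \<in> prob_vecs \<and> p v* K = p"

text \<open>The kernel \<open>K(\<cdot>,\<cdot>,0,v)\<close>; only the value \<open>0\<close> of its third argument is needed.\<close>

definition limit_kernel :: "real ^ 'e::finite ^ 'e \<Rightarrow> real ^ 'e \<Rightarrow> real ^ 'e ^ 'e" where
  "limit_kernel U v = normalize_rows (\<chi> x y. U $ x $ y * v $ y)"

text \<open>For positive \<open>U\<close> and a probability vector \<open>v\<close>, the support of \<open>v\<close> is the only recurrent class
  of the kernel, so that the description below singles out exactly one vector.\<close>

definition limit_invariant :: "real ^ 'e::finite ^ 'e \<Rightarrow> real ^ 'e \<Rightarrow> real ^ 'e" where
  "limit_invariant U v = (THE p. invariant_prob (limit_kernel U v) p)"


section \<open>Vertex reinforced random walk\<close>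

text \<open>Time starts at \<open>1\<close>: the values \<open>X 0\<close> and \<open>a 0\<close> are never used.\<close>

definition walk_sigma :: "'w measure \<Rightarrow> (nat \<Rightarrow> 'w \<Rightarrow> 'e) \<Rightarrow> nat \<Rightarrow> 'w measure" where
  "walk_sigma M X n = sigma (space M) {X i -` A \<inter> space M | i A. i \<in> {1..n}}"

lemma subalgebra_walk_sigma:
  assumes "\<And>i. i \<ge> 1 \<Longrightarrow> X i \<in> measurable M (count_space UNIV)"
  shows "subalgebra M (walk_sigma M X n)"
proof -
  have "{X i -` A \<inter> space M | i A. i \<in> {1..n}} \<subseteq> sets M"
    using assms by (auto intro!: measurable_sets)
  then show ?thesis
    unfolding subalgebra_def walk_sigma_def
    by (subst sets_measure_of)
       (auto intro!: sets.sigma_sets_subset simp: space_measure_of_conv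
             dest: sets.sets_into_space)
qed

definition vrrw_matrix ::
  "real ^ 'e::finite ^ 'e \<Rightarrow> (nat \<Rightarrow> real) \<Rightarrow> (nat \<Rightarrow> 'w \<Rightarrow> 'e) \<Rightarrow> nat \<Rightarrow> 'w \<Rightarrow> real ^ 'e ^ 'e" where
  "vrrw_matrix U a X n \<omega> =
     normalize_rows (\<chi> x y. U $ x $ y * (1 + (\<Sum>i=1..n. a i * of_bool (X i \<omega> = y))))"

definition vrrw ::
  "'w measure \<Rightarrow> real ^ 'e::finite ^ 'e \<Rightarrow> (nat \<Rightarrow> real) \<Rightarrow> (nat \<Rightarrow> 'w \<Rightarrow> 'e) \<Rightarrow> bool" where
  "vrrw M U a X \<longleftrightarrow>
     prob_space M \<and>
     (\<forall>n\<ge>1. X n \<in> measurable M (count_space UNIV)) \<and>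
     (\<forall>n\<ge>1. \<forall>y. AE \<omega> in M.
        real_cond_exp M (walk_sigma M X n) (indicator {\<omega>' \<in> space M. X (Suc n) \<omega>' = y}) \<omega>
          = vrrw_matrix U a X n \<omega> $ X n \<omega> $ y)"

definition occupation :: "(nat \<Rightarrow> 'w \<Rightarrow> 'e::finite) \<Rightarrow> nat \<Rightarrow> 'w \<Rightarrow> real ^ 'e" where
  "occupation X n \<omega> = (1 / real n) *\<^sub>R (\<Sum>i=1..n. axis (X i \<omega>) 1)"


section \<open>Limit sets and internal chain transitivity\<close>

definition limit_set :: "(nat \<Rightarrow> 'a::topological_space) \<Rightarrow> 'a set" where
  "limit_set v = {p. \<exists>k. filterlim k at_top sequentially \<and> (\<lambda>j. v (k j)) \<longlonglongrightarrow> p}"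

definition abs_continuous_on :: "real set \<Rightarrow> (real \<Rightarrow> 'a::real_normed_vector) \<Rightarrow> bool" where
  "abs_continuous_on S f \<longleftrightarrow>
     (\<forall>\<epsilon>>0. \<exists>\<delta>>0. \<forall>(n::nat) l u.
        (\<forall>i<n. l i \<le> u i \<and> {l i..u i} \<subseteq> S) \<and>
        (\<forall>i<n. \<forall>j<n. i \<noteq> j \<longrightarrow> {l i<..<u i} \<inter> {l j<..<u j} = {}) \<and>
        (\<Sum>i<n. u i - l i) < \<delta>
        \<longrightarrow> (\<Sum>i<n. norm (f (u i) - f (l i))) < \<epsilon>)"

text \<open>Solutions of \<open>v' = F(v)\<close> with values in \<open>D\<close>. On the whole line, absolute continuity means
  absolute continuity on every compact interval.\<close>

definition ode_solution ::
  "('a::real_normed_vector \<Rightarrow> 'a) \<Rightarrow> 'a set \<Rightarrow> (real \<Rightarrow> 'a) \<Rightarrow> bool" where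
  "ode_solution F D v \<longleftrightarrow>
     (\<forall>t. v t \<in> D) \<and>
     (\<forall>s t. abs_continuous_on {s..t} v) \<and>
     (AE t in lborel. (v has_vector_derivative F (v t)) (at t))"

definition chain_connected ::
  "('a::real_normed_vector \<Rightarrow> 'a) \<Rightarrow> 'a set \<Rightarrow> 'a set \<Rightarrow> 'a \<Rightarrow> 'a \<Rightarrow> bool" where
  "chain_connected F D A x y \<longleftrightarrow>
     (\<forall>\<epsilon>>0. \<forall>T>0. \<exists>(n::nat) \<xi> t.
        n \<ge> 1 \<and>
        (\<forall>i\<in>{1..n}. ode_solution F D (\<xi> i) \<and> t i > T \<and> \<xi> i ` {0..t i} \<subseteq> A) \<and>
        (\<forall>i\<in>{1..<n}. norm (\<xi> i (t i) - \<xi> (Suc i) 0) \<le> \<epsilon>) \<and>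
        norm (\<xi> 1 0 - x) \<le> \<epsilon> \<and>
        norm (\<xi> n (t n) - y) \<le> \<epsilon>)"

definition internally_chain_transitive ::
  "('a::real_normed_vector \<Rightarrow> 'a) \<Rightarrow> 'a set \<Rightarrow> 'a set \<Rightarrow> bool" where
  "internally_chain_transitive F D A \<longleftrightarrow>
     A \<subseteq> D \<and> compact A \<and> (\<forall>x\<in>A. \<forall>y\<in>A. chain_connected F D A x y)"

end

theory Submission
  imports Defs "HOL-Complex_Analysis.Great_Picard"
begin

text \<open>
  Write \<open>K(v)\<close> for the kernel with entries proportional to \<open>U(x,y) v(y)\<close> and \<open>\<pi>(v)\<close> for its invariant
  probability. The idea is to show that, almost surely,
  \<open>v\<^sub>n - (1/n) \<Sum>\<^sub>i\<^sub><\<^sub>n \<pi>(v\<^sub>i) \<rightarrow> 0\<close>. Everything else is then deterministic, since this relation is a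
  discrete version of \<open>d/dy (y v(y)) = \<pi>(v(y))\<close>, which in the time \<open>t = ln y\<close> reads
  \<open>v' = -v + \<pi>(v)\<close>.

  \<^emph>\<open>Freezing the weights.\<close> The transition matrix of the walk at time \<open>n\<close> is exactly \<open>K(w\<^sub>n)\<close>, where
  \<open>w\<^sub>n\<close> is the normalized \<open>a\<close>-weighted occupation measure with one extra unit of mass at each point. Slow
  variation means that \<open>a\<^sub>i / a\<^sub>n\<close> is close to \<open>1\<close> for most \<open>i \<le> n\<close>; in the decreasing case the function
  \<open>b\<close> shows that the small indices carry little mass. Hence \<open>w\<^sub>n - v\<^sub>n \<rightarrow> 0\<close>
  (\<open>weighted_occupation_close\<close>).

  \<^emph>\<open>Averaging.\<close> Since \<open>U\<close> is positive, \<open>K(v)(x,\<cdot>) \<ge> c v\<close> with the same \<open>c > 0\<close> for all \<open>v\<close> and \<open>x\<close>. So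
  \<open>I - K(v) + c 1\<otimes>v\<close> satisfies a minimum principle, is invertible on the whole simplex, including the
  boundary, where \<open>K(v)\<close> is not irreducible, and its inverse yields \<open>\<pi>\<close> and solutions of the Poisson
  equation that depend continuously on \<open>v\<close> (\<open>poisson_equation_family\<close>). By that equation
  \<open>1(X\<^sub>i\<^sub>+\<^sub>1 = y) - \<pi>(w\<^sub>i)(y)\<close> is a bounded martingale increment plus a telescoping term plus a term
  that is small because \<open>w\<^sub>i\<^sub>+\<^sub>1 - w\<^sub>i \<rightarrow> 0\<close>. A strong law for bounded orthogonal variables
  (\<open>bounded_orthogonal_slln\<close>) removes the first and Cesaro averaging the others
  (\<open>occupation_averages_invariant\<close>).

  \<^emph>\<open>Chain transitivity.\<close> As \<open>v\<^sub>n\<close> moves by at most \<open>2(n-m)/n\<close> between \<open>m\<close> and \<open>n\<close>, the functions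
  \<open>y \<mapsto> v\<^bsub>\<lfloor>N y\<rfloor>\<^esub>\<close> have limit points as \<open>N \<rightarrow> \<infinity>\<close>, and by the averaging relation each of them is,
  in logarithmic time, a solution on the whole real line which stays in the limit set. By
  compactness every long piece of \<open>(v\<^sub>n)\<close> far out is therefore shadowed at its two ends by such a
  solution (\<open>shadowing\<close>). Cutting the stretch between a visit near \<open>x\<close> and a later visit near \<open>y\<close> into
  pieces of equal logarithmic length gives the required chain.
\<close>

section \<open>Poisson equations for uniformly minorized kernels\<close>

text \<open>\<open>I - K\<close> kills constants; adding the rank-one matrix \<open>c 1\<otimes>\<mu>\<close> repairs this. If \<open>g\<close> is mapped to \<open>f\<close>, then
  \<open>g - K g = f - c \<mu>(g)\<close>, and integrating against an invariant probability \<open>\<pi>\<close> shows that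
  \<open>c \<mu>(g) = \<pi>(f)\<close>. So \<open>g\<close> solves the Poisson equation for \<open>f\<close>.\<close>

definition poisson_op :: "real \<Rightarrow> real ^ 'e::finite \<Rightarrow> real ^ 'e ^ 'e \<Rightarrow> real ^ 'e ^ 'e" where
  "poisson_op c \<mu> K = (\<chi> x y. of_bool (x = y) - K $ x $ y + c * \<mu> $ y)"

lemma poisson_op_apply:
  "(poisson_op c \<mu> K *v g) $ x = g $ x - (\<Sum>y\<in>UNIV. K $ x $ y * g $ y) + c * (\<mu> \<bullet> g)"
proof -
  have "(poisson_op c \<mu> K *v g) $ x
      = (\<Sum>y\<in>UNIV. of_bool (x = y) * g $ y - K $ x $ y * g $ y + c * (\<mu> $ y * g $ y))"
    by (simp add: poisson_op_def matrix_vector_mult_def algebra_simps)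
  also have "\<dots> = g $ x - (\<Sum>y\<in>UNIV. K $ x $ y * g $ y) + c * (\<mu> \<bullet> g)"
    by (simp add: sum.distrib sum_subtractf sum_distrib_left inner_vec_def of_bool_def
        if_distrib[of "\<lambda>u. u * _"] cong: if_cong)
  finally show ?thesis .
qed

text \<open>At a minimum \<open>x0\<close> of \<open>g\<close>, the matrix \<open>K - c 1\<otimes>\<mu>\<close>, which is nonnegative with row sums \<open>1 - c\<close>, averages
  \<open>g\<close> to at least \<open>(1 - c) g(x0)\<close>. So \<open>g(x0) \<ge> (1 - c) g(x0)\<close>, that is, \<open>g(x0) \<ge> 0\<close>.\<close>

lemma poisson_op_min_principle:
  fixes K :: "real ^ 'e::finite ^ 'e"
  assumes "c > 0" and minor: "\<And>x y. c * \<mu> $ y \<le> K $ x $ y"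
    and rows: "\<And>x. (\<Sum>y\<in>UNIV. K $ x $ y) = 1" and \<mu>: "\<mu> \<in> prob_vecs"
    and nonneg: "\<And>x. 0 \<le> (poisson_op c \<mu> K *v g) $ x"
  shows "0 \<le> g $ x"
proof -
  have "Min (range (($) g)) \<in> range (($) g)" by (intro Min_in) auto
  then obtain x0 where x0: "g $ x0 = Min (range (($) g))" by (metis imageE)
  have least: "g $ x0 \<le> g $ y" for y unfolding x0 by (intro Min_le) auto
  have "(1 - c) * g $ x0 = (\<Sum>y\<in>UNIV. (K $ x0 $ y - c * \<mu> $ y) * g $ x0)"
    using \<mu> by (simp add: sum_distrib_right[symmetric] sum_subtractf rows
        sum_distrib_left[symmetric] prob_vecs_def)
  also have "\<dots> \<le> (\<Sum>y\<in>UNIV. (K $ x0 $ y - c * \<mu> $ y) * g $ y)"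
    using minor least by (intro sum_mono mult_left_mono) (auto simp: algebra_simps)
  also have "\<dots> = (\<Sum>y\<in>UNIV. K $ x0 $ y * g $ y) - c * (\<mu> \<bullet> g)"
    by (simp add: inner_vec_def sum_distrib_left sum_subtractf[symmetric] algebra_simps)
  also have "\<dots> \<le> g $ x0"
    using nonneg[of x0] by (simp add: poisson_op_apply)
  finally have "0 \<le> c * g $ x0" by (simp add: algebra_simps)
  with \<open>c > 0\<close> have "0 \<le> g $ x0" by (simp add: zero_le_mult_iff)
  with least show ?thesis by (meson order_trans)
qed

lemma poisson_op_invertible:
  fixes K :: "real ^ 'e::finite ^ 'e"
  assumes "c > 0" and "\<And>x y. c * \<mu> $ y \<le> K $ x $ y"
    and "\<And>x. (\<Sum>y\<in>UNIV. K $ x $ y) = 1" and "\<mu> \<in> prob_vecs"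
  shows "invertible (poisson_op c \<mu> K)"
proof -
  have "g = 0" if g: "poisson_op c \<mu> K *v g = 0" for g
  proof -
    have "poisson_op c \<mu> K *v (- g) = 0"
      using g by (simp add: vec.neg)
    then have "0 \<le> g $ x" "0 \<le> (- g) $ x" for x
      using g by (auto intro: poisson_op_min_principle[OF assms, of g]
          poisson_op_min_principle[OF assms, of "- g", simplified])
    then show "g = 0" by (simp add: vec_eq_iff order_antisym)
  qed
  then show ?thesis
    by (simp add: invertible_left_inverse matrix_left_invertible_ker)
qed

lemma matrix_inv_right: "invertible A \<Longrightarrow> A ** matrix_inv A = mat 1"
  and matrix_inv_left: "invertible A \<Longrightarrow> matrix_inv A ** A = mat 1"
  for A :: "real ^ 'n ^ 'n"
  unfolding matrix_inv_def invertible_def by (metis (mono_tags, lifting) someI_ex)+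

text \<open>If \<open>p\<close> is invariant, integrating \<open>f = A g\<close> against \<open>p\<close>, with \<open>A\<close> the operator above, gives
  \<open>p(f) = c \<mu>(g)\<close>, so \<open>p\<close> is determined. Conversely that formula defines an invariant vector, of mass
  one because \<open>A 1 = c 1\<close>, and nonnegative by the minimum principle. Irreducibility is replaced by
  the minorization throughout.\<close>

lemma invariant_prob_iff:
  fixes K :: "real ^ 'e::finite ^ 'e"
  assumes c: "c > 0" and minor: "\<And>x y. c * \<mu> $ y \<le> K $ x $ y"
    and rows: "\<And>x. (\<Sum>y\<in>UNIV. K $ x $ y) = 1" and \<mu>: "\<mu> \<in> prob_vecs"
  defines "Q \<equiv> matrix_inv (poisson_op c \<mu> K)"
  shows "invariant_prob K p \<longleftrightarrow> p = c *\<^sub>R (\<mu> v* Q)"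
proof -
  let ?A = "poisson_op c \<mu> K" and ?q = "c *\<^sub>R (\<mu> v* Q)"
  have inv: "?A ** Q = mat 1" "Q ** ?A = mat 1"
    using poisson_op_invertible[OF assms(1-4)] by (auto simp: Q_def matrix_inv_left matrix_inv_right)
  have AQ: "?A *v (Q *v f) = f" for f
    by (simp add: matrix_vector_mul_assoc inv)
  have q_inner: "?q \<bullet> f = c * (\<mu> \<bullet> (Q *v f))" for f
    by (simp add: dot_lmul_matrix)
  have \<mu>1: "\<mu> \<bullet> 1 = 1" using \<mu> by (simp add: prob_vecs_def inner_vec_def)
  have inner_A: "r \<bullet> (?A *v g) = r \<bullet> g - (r v* K) \<bullet> g + c * (\<mu> \<bullet> g) * (r \<bullet> 1)" for r g
  proof -
    have "?A *v g = g - K *v g + (c * (\<mu> \<bullet> g)) *\<^sub>R 1"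
      by (simp add: vec_eq_iff poisson_op_apply) (simp add: matrix_vector_mult_def)
    then show ?thesis
      by (simp add: inner_diff_right inner_add_right dot_lmul_matrix)
  qed
  show ?thesis
  proof
    assume "invariant_prob K p"
    then have p: "p \<bullet> 1 = 1" "p v* K = p"
      by (auto simp: invariant_prob_def prob_vecs_def inner_vec_def)
    have "p \<bullet> f = ?q \<bullet> f" for f
      using inner_A[of p "Q *v f"] unfolding q_inner by (simp add: AQ p)
    then show "p = ?q" by (rule vector_eq_rdot[THEN iffD1, rule_format])
  next
    assume p: "p = ?q"
    have "?A *v 1 = c *\<^sub>R 1"
      using \<mu>1 by (simp add: vec_eq_iff poisson_op_apply rows)
    moreover have "Q *v (?A *v 1) = 1" by (simp add: matrix_vector_mul_assoc inv)
    ultimately have "c *\<^sub>R (Q *v 1) = 1" by (simp add: matrix_vector_mult_scaleR)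
    with \<mu>1 have "\<mu> \<bullet> (c *\<^sub>R (Q *v 1)) = 1" by (simp only:)
    then have q1: "?q \<bullet> 1 = 1" unfolding q_inner inner_scaleR_right .
    have "0 \<le> (Q *v axis y 1) $ x" for x y
      using assms(1-4) by (rule poisson_op_min_principle) (simp add: AQ axis_def)
    then have "0 \<le> ?q \<bullet> axis y 1" for y
      unfolding q_inner using c \<mu>
      by (auto simp: inner_vec_def prob_vecs_def intro!: mult_nonneg_nonneg sum_nonneg)
    then have "?q \<in> prob_vecs"
      using q1 by (auto simp: prob_vecs_def inner_axis) (simp add: inner_vec_def sum_distrib_left)
    moreover have "?q v* K = ?q"
    proof -
      have qA: "?q \<bullet> (?A *v g) = c * (\<mu> \<bullet> g)" for g
        unfolding q_inner by (simp add: matrix_vector_mul_assoc inv)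
      have "(?q v* K) \<bullet> g = ?q \<bullet> g" for g
        using inner_A[of ?q g] unfolding q1 qA by linarith
      then show ?thesis by (rule vector_eq_rdot[THEN iffD1, rule_format])
    qed
    ultimately show "invariant_prob K p" by (simp add: p invariant_prob_def)
  qed
qed

text \<open>By Cramer's rule the entries of the inverse are quotients of polynomials in the entries.\<close>

lemma continuous_on_matrix_inv:
  fixes A :: "'a::topological_space \<Rightarrow> real ^ 'n ^ 'n"
  assumes "\<And>i j. continuous_on S (\<lambda>v. A v $ i $ j)" and "\<And>v. v \<in> S \<Longrightarrow> invertible (A v)"
  shows "continuous_on S (\<lambda>v. matrix_inv (A v) $ i $ j)"
proof -
  have det: "continuous_on S (\<lambda>v. det (B v))"
    if "\<And>i j. continuous_on S (\<lambda>v. B v $ i $ j)" for B :: "'a \<Rightarrow> real ^ 'n ^ 'n"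
    unfolding det_def by (intro continuous_intros that)
  have nz: "det (A v) \<noteq> 0" if "v \<in> S" for v
    using assms(2)[OF that] by (simp add: invertible_det_nz)
  have "continuous_on S
      (\<lambda>v. det (\<chi> k l. if l = i then axis j 1 $ k else A v $ k $ l) / det (A v))"
  proof (intro continuous_on_divide det)
    show "continuous_on S (\<lambda>v. (\<chi> k l. if l = i then axis j 1 $ k else A v $ k $ l) $ m $ n)" for m n
      using assms(1) by (cases "n = i") auto
  qed (use assms(1) nz in auto)
  moreover have "matrix_inv (A v) $ i $ j
      = det (\<chi> k l. if l = i then axis j 1 $ k else A v $ k $ l) / det (A v)" if "v \<in> S" for v
  proof -
    have "A v *v (matrix_inv (A v) *v axis j 1) = axis j 1"
      using matrix_inv_right[OF assms(2)[OF that]] by (simp add: matrix_vector_mul_assoc)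
    then have "matrix_inv (A v) *v axis j 1
        = (\<chi> i. det (\<chi> k l. if l = i then axis j 1 $ k else A v $ k $ l) / det (A v))"
      using cramer[OF nz[OF that]] by blast
    moreover have "(matrix_inv (A v) *v axis j 1) $ i = matrix_inv (A v) $ i $ j"
      by (simp add: matrix_vector_mult_basis column_def)
    ultimately show ?thesis by simp
  qed
  ultimately show ?thesis by (simp cong: continuous_on_cong)
qed

lemma positive_matrix_bounds:
  fixes U :: "real ^ 'e::finite ^ 'e"
  assumes "\<forall>x y. U $ x $ y > 0"
  obtains m B where "m > 0" "B > 0" "\<And>x y. m \<le> U $ x $ y" "\<And>x y. U $ x $ y \<le> B"
proof
  let ?R = "range (\<lambda>(x, y). U $ x $ y)"
  have fin: "finite ?R" "?R \<noteq> {}" by auto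
  show "Min ?R > 0" using assms fin by (auto simp: Min_gr_iff)
  show *: "Min ?R \<le> U $ x $ y" for x y using fin by (intro Min_le) (auto intro!: image_eqI[of _ _ "(x,y)"])
  show "U $ x $ y \<le> Max ?R" for x y using fin by (intro Max_ge) (auto intro!: image_eqI[of _ _ "(x,y)"])
  then show "Max ?R > 0" using assms by (meson less_le_trans)
qed

lemma prob_vecs_le_1: "v \<in> prob_vecs \<Longrightarrow> v $ x \<le> 1"
  unfolding prob_vecs_def using member_le_sum[of x UNIV "\<lambda>x. v $ x"] by auto

lemma weighted_row_sum_bounds:
  fixes U :: "real ^ 'e::finite ^ 'e"
  assumes "v \<in> prob_vecs" and "\<And>x y. m \<le> U $ x $ y" and "\<And>x y. U $ x $ y \<le> B"
  shows "m \<le> (\<Sum>z\<in>UNIV. U $ x $ z * v $ z)" "(\<Sum>z\<in>UNIV. U $ x $ z * v $ z) \<le> B"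
proof -
  have "(\<Sum>z\<in>UNIV. m * v $ z) \<le> (\<Sum>z\<in>UNIV. U $ x $ z * v $ z)"
    using assms by (intro sum_mono mult_right_mono) (auto simp: prob_vecs_def)
  moreover have "(\<Sum>z\<in>UNIV. U $ x $ z * v $ z) \<le> (\<Sum>z\<in>UNIV. B * v $ z)"
    using assms by (intro sum_mono mult_right_mono) (auto simp: prob_vecs_def)
  ultimately show "m \<le> (\<Sum>z\<in>UNIV. U $ x $ z * v $ z)" "(\<Sum>z\<in>UNIV. U $ x $ z * v $ z) \<le> B"
    using assms(1) by (auto simp: prob_vecs_def sum_distrib_left[symmetric])
qed

lemma limit_kernel_nth:
  "limit_kernel U v $ x $ y = U $ x $ y * v $ y / (\<Sum>z\<in>UNIV. U $ x $ z * v $ z)"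
  by (simp add: limit_kernel_def normalize_rows_def)

text \<open>The constant \<open>c = min U / max U\<close> serves all \<open>v\<close> at once; this uniformity is what makes the Poisson
  solutions continuous up to the boundary of the simplex.\<close>

lemma limit_kernel_minorized:
  fixes U :: "real ^ 'e::finite ^ 'e"
  assumes "\<forall>x y. U $ x $ y > 0"
  obtains c where "c > 0"
    "\<And>v x y. v \<in> prob_vecs \<Longrightarrow> c * v $ y \<le> limit_kernel U v $ x $ y"
proof -
  obtain m B where U: "m > 0" "B > 0" "\<And>x y. m \<le> U $ x $ y" "\<And>x y. U $ x $ y \<le> B"
    using positive_matrix_bounds[OF assms] by blast
  show thesis
  proof
    show "m / B > 0" using U by simp
    fix v :: "real ^ 'e" and x y assume v: "v \<in> prob_vecs"
    let ?S = "\<Sum>z\<in>UNIV. U $ x $ z * v $ z"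
    have S: "m \<le> ?S" "?S \<le> B" using weighted_row_sum_bounds[OF v U(3,4)] by auto
    have "m / B \<le> U $ x $ y / ?S"
      using U(1,2) U(3)[of x y] S by (intro frac_le) linarith+
    then have "m / B * v $ y \<le> U $ x $ y / ?S * v $ y"
      using v by (intro mult_right_mono) (auto simp: prob_vecs_def)
    then show "m / B * v $ y \<le> limit_kernel U v $ x $ y" by (simp add: limit_kernel_nth)
  qed
qed

lemma limit_kernel_denominator_pos:
  fixes U :: "real ^ 'e::finite ^ 'e"
  assumes "\<forall>x y. U $ x $ y > 0" and "v \<in> prob_vecs"
  shows "(\<Sum>z\<in>UNIV. U $ x $ z * v $ z) > 0"
proof -
  obtain m B where U: "m > 0" "B > 0" "\<And>x y. m \<le> U $ x $ y" "\<And>x y. U $ x $ y \<le> B"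
    using positive_matrix_bounds[OF assms(1)] by blast
  have "m \<le> (\<Sum>z\<in>UNIV. U $ x $ z * v $ z)"
    by (rule weighted_row_sum_bounds(1)[OF assms(2) U(3,4)])
  with U(1) show ?thesis by linarith
qed

lemma limit_kernel_rows:
  fixes U :: "real ^ 'e::finite ^ 'e"
  assumes "\<forall>x y. U $ x $ y > 0" and "v \<in> prob_vecs"
  shows "(\<Sum>y\<in>UNIV. limit_kernel U v $ x $ y) = 1"
  using limit_kernel_denominator_pos[OF assms, of x]
  by (simp add: limit_kernel_nth sum_divide_distrib[symmetric])

lemma limit_kernel_nonneg:
  assumes "\<forall>x y. U $ x $ y > 0" and "v \<in> prob_vecs"
  shows "0 \<le> limit_kernel U v $ x $ y"
  using limit_kernel_denominator_pos[OF assms, of x] assms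
  by (auto simp: limit_kernel_nth prob_vecs_def less_imp_le)

lemma continuous_on_limit_kernel:
  assumes "\<forall>x y. U $ x $ y > 0"
  shows "continuous_on prob_vecs (\<lambda>v. limit_kernel U v $ x $ y)"
  unfolding limit_kernel_nth
  by (intro continuous_intros) (use limit_kernel_denominator_pos[OF assms] in \<open>metis less_irrefl\<close>)

text \<open>The matrix \<open>G v\<close> is the inverse of the modified operator with \<open>\<mu> = v\<close>. Its column \<open>y\<close> solves the Poisson
  equation for the indicator of \<open>y\<close>.\<close>

proposition poisson_equation_family:
  fixes U :: "real ^ 'e::finite ^ 'e"
  assumes U: "\<forall>x y. U $ x $ y > 0"
  obtains G :: "real ^ 'e \<Rightarrow> real ^ 'e ^ 'e" where
    "\<And>x y. continuous_on prob_vecs (\<lambda>v. G v $ x $ y)"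
    "\<And>v x y. v \<in> prob_vecs \<Longrightarrow>
       G v $ x $ y - (\<Sum>z\<in>UNIV. limit_kernel U v $ x $ z * G v $ z $ y)
         = of_bool (x = y) - limit_invariant U v $ y"
    "continuous_on prob_vecs (limit_invariant U)"
proof -
  obtain c where c: "c > 0"
      "\<And>v x y. v \<in> prob_vecs \<Longrightarrow> c * v $ y \<le> limit_kernel U v $ x $ y"
    using limit_kernel_minorized[OF U] by metis
  define A where "A v = poisson_op c v (limit_kernel U v)" for v
  define G where "G v = matrix_inv (A v)" for v
  have inv: "invertible (A v)" if "v \<in> prob_vecs" for v
    unfolding A_def using c that limit_kernel_rows[OF U] by (intro poisson_op_invertible) auto
  have iff: "invariant_prob (limit_kernel U v) p \<longleftrightarrow> p = c *\<^sub>R (v v* G v)"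
    if "v \<in> prob_vecs" for v p
    unfolding G_def A_def using c that limit_kernel_rows[OF U] by (intro invariant_prob_iff) auto
  then have \<pi>: "limit_invariant U v = c *\<^sub>R (v v* G v)" if "v \<in> prob_vecs" for v
    using that unfolding limit_invariant_def by (intro the_equality) auto
  show thesis
  proof
    show cont: "continuous_on prob_vecs (\<lambda>v. G v $ x $ y)" for x y
      unfolding G_def
    proof (rule continuous_on_matrix_inv)
      show "continuous_on prob_vecs (\<lambda>v. A v $ i $ j)" for i j
        unfolding A_def poisson_op_def
        by (simp only: vec_lambda_beta, intro continuous_intros continuous_on_limit_kernel U)
    qed (rule inv)
    have "continuous_on prob_vecs (\<lambda>v. \<chi> y. c * (\<Sum>x\<in>UNIV. v $ x * G v $ x $ y))"
      by (intro continuous_intros cont)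
    then show "continuous_on prob_vecs (limit_invariant U)"
      by (rule continuous_on_eq) (simp add: \<pi> vector_matrix_mult_def vec_eq_iff)
    show "G v $ x $ y - (\<Sum>z\<in>UNIV. limit_kernel U v $ x $ z * G v $ z $ y)
         = of_bool (x = y) - limit_invariant U v $ y" if v: "v \<in> prob_vecs" for v x y
    proof -
      define g where "g = G v *v axis y 1"
      have g: "g $ z = G v $ z $ y" for z
        by (simp add: g_def matrix_vector_mult_basis column_def)
      have "A v *v g = axis y 1"
        unfolding g_def G_def using matrix_inv_right[OF inv[OF v]] by (simp add: matrix_vector_mul_assoc)
      then have "g $ x - (\<Sum>z\<in>UNIV. limit_kernel U v $ x $ z * g $ z) + c * (v \<bullet> g) = of_bool (x = y)"
        using poisson_op_apply[of c v "limit_kernel U v" g x] by (auto simp: A_def axis_def)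
      moreover have "c * (v \<bullet> g) = limit_invariant U v $ y"
        by (simp add: \<pi>[OF v] g inner_vec_def vector_matrix_mult_def mult.commute)
      ultimately show ?thesis by (simp add: g)
    qed
  qed
qed

section \<open>Slowly varying weights and the occupation measure\<close>

lemma cesaro_null:
  fixes x :: "nat \<Rightarrow> 'a::real_normed_vector"
  assumes "x \<longlonglongrightarrow> 0"
  shows "(\<lambda>n. (1 / real n) *\<^sub>R (\<Sum>i<n. x i)) \<longlonglongrightarrow> 0"
proof (rule tendsto_norm_zero_cancel, rule LIMSEQ_I)
  fix \<epsilon> :: real assume \<epsilon>: "\<epsilon> > 0"
  obtain N where N: "\<And>i. i \<ge> N \<Longrightarrow> norm (x i) < \<epsilon> / 2"
    using LIMSEQ_D[OF assms, of "\<epsilon> / 2"] \<epsilon> by auto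
  define C where "C = (\<Sum>i<N. norm (x i))"
  have C: "C \<ge> 0" by (simp add: C_def sum_nonneg)
  have "norm ((1 / real n) *\<^sub>R (\<Sum>i<n. x i)) < \<epsilon>" if n: "n > N" "real n > 2 * C / \<epsilon>" for n
  proof -
    have "norm (\<Sum>i<n. x i) \<le> (\<Sum>i<n. norm (x i))" by (rule norm_sum)
    also have "\<dots> = C + (\<Sum>i\<in>{N..<n}. norm (x i))"
      unfolding C_def using n by (simp add: sum.atLeastLessThan_concat lessThan_atLeast0)
    also have "(\<Sum>i\<in>{N..<n}. norm (x i)) \<le> (\<Sum>i\<in>{N..<n}. \<epsilon> / 2)"
      using N by (intro sum_mono) (auto intro: less_imp_le)
    also have "\<dots> \<le> real n * (\<epsilon> / 2)" using \<epsilon> by (simp add: field_simps)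
    also have "C < real n * (\<epsilon> / 2)" using n \<epsilon> by (simp add: field_simps)
    finally have "norm (\<Sum>i<n. x i) < real n * \<epsilon>" by (simp add: mult.commute)
    then show ?thesis using n by (simp add: field_simps)
  qed
  moreover obtain N' :: nat where "real N' > 2 * C / \<epsilon>" using reals_Archimedean2 by blast
  ultimately show "\<exists>n0. \<forall>n\<ge>n0. norm (norm ((1 / real n) *\<^sub>R (\<Sum>i<n. x i)) - 0) < \<epsilon>"
    by (intro exI[of _ "Suc N + N'"]) auto
qed

text \<open>If \<open>a\<^sub>i / a\<^sub>n\<close> is close to \<open>1\<close> on average over \<open>i \<le> n\<close>, then the partial sum \<open>r\<^sub>n\<close> is close to \<open>n a\<^sub>n\<close>, so
  that \<open>a\<^sub>n\<close> may be replaced by \<open>r\<^sub>n / n\<close>.\<close>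

lemma self_normalized_weights:
  fixes a :: "nat \<Rightarrow> real"
  assumes pos: "\<And>n. n \<ge> 1 \<Longrightarrow> a n > 0"
    and last: "(\<lambda>n. (1 / real n) * (\<Sum>i=1..n. \<bar>a i / a n - 1\<bar>)) \<longlonglongrightarrow> 0"
  shows "(\<lambda>n. \<Sum>i=1..n. \<bar>a i / (\<Sum>j=1..n. a j) - 1 / real n\<bar>) \<longlonglongrightarrow> 0"
proof -
  define q where "q n = (1 / real n) * (\<Sum>i=1..n. \<bar>a i / a n - 1\<bar>)" for n
  have q0: "q \<longlonglongrightarrow> 0" using last by (simp add: q_def[abs_def])
  have bound: "(\<Sum>i=1..n. \<bar>a i / (\<Sum>j=1..n. a j) - 1 / real n\<bar>) \<le> 4 * q n"
    if n: "n \<ge> 1" and qn: "q n < 1 / 2" for n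
  proof -
    \<comment> \<open>The quotient \<open>\<rho>\<close> of \<open>r\<^sub>n\<close> and \<open>n a\<^sub>n\<close> differs from \<open>1\<close> by at most the average \<open>q n\<close>; as this is below
      \<open>1/2\<close>, dividing by \<open>\<rho>\<close> costs at most a factor \<open>2\<close>.\<close>
    define \<rho> where "\<rho> = (\<Sum>j=1..n. a j) / (real n * a n)"
    have an: "a n > 0" using pos n by auto
    have "\<rho> - 1 = (1 / real n) * (\<Sum>i=1..n. a i / a n - 1)"
      using n an by (simp add: \<rho>_def sum_subtractf sum_divide_distrib[symmetric] field_simps)
    also have "\<bar>\<dots>\<bar> \<le> q n"
      unfolding q_def abs_mult by (intro mult_mono) auto
    finally have \<rho>: "\<bar>\<rho> - 1\<bar> \<le> q n" .
    then have \<rho>_half: "\<rho> > 1 / 2" using qn by linarith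
    have r: "(\<Sum>j=1..n. a j) = \<rho> * (real n * a n)" using n an by (simp add: \<rho>_def)
    have "\<bar>a i / (\<Sum>j=1..n. a j) - 1 / real n\<bar>
        \<le> 2 * (1 / real n) * (\<bar>a i / a n - 1\<bar> + q n)" for i
    proof -
      have "a i / (\<Sum>j=1..n. a j) - 1 / real n = (1 / \<rho>) * (1 / real n) * ((a i / a n - 1) - (\<rho> - 1))"
        unfolding r using n an \<rho>_half by (simp add: field_simps)
      also have "\<bar>\<dots>\<bar> = (1 / \<rho>) * (1 / real n) * \<bar>(a i / a n - 1) - (\<rho> - 1)\<bar>"
        using \<rho>_half by (simp add: abs_mult)
      also have "\<dots> \<le> 2 * (1 / real n) * (\<bar>a i / a n - 1\<bar> + q n)"
        using \<rho> \<rho>_half by (intro mult_mono) (auto simp: field_simps)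
      finally show ?thesis .
    qed
    then have "(\<Sum>i=1..n. \<bar>a i / (\<Sum>j=1..n. a j) - 1 / real n\<bar>)
        \<le> (\<Sum>i=1..n. 2 * (1 / real n) * (\<bar>a i / a n - 1\<bar> + q n))"
      by (intro sum_mono)
    also have "\<dots> = 2 * (q n + q n)"
      using n by (simp add: sum_distrib_left[symmetric] sum.distrib q_def distrib_left
          sum_divide_distrib[symmetric])
    finally show ?thesis by simp
  qed
  have "eventually (\<lambda>n. q n < 1 / 2) sequentially"
    using order_tendstoD(2)[OF q0, of "1/2"] by simp
  then have "eventually (\<lambda>n. (\<Sum>i=1..n. \<bar>a i / (\<Sum>j=1..n. a j) - 1 / real n\<bar>) \<le> 4 * q n)
      sequentially"
    using eventually_ge_at_top[of "1::nat"] by eventually_elim (rule bound)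
  moreover have "(\<lambda>n. 4 * q n) \<longlonglongrightarrow> 0" using tendsto_mult_left[OF q0, of 4] by simp
  ultimately show ?thesis
    by (rule tendsto_sandwich[OF always_eventually _ tendsto_const, rotated]) (simp add: sum_nonneg)
qed

text \<open>The pattern common to the two monotone cases, with \<open>f n i = \<bar>\<alpha>(i) / \<alpha>(n) - 1\<bar>\<close>: away from \<open>0\<close>,
  that is for \<open>i \<ge> \<delta> n\<close>, monotonicity reduces the estimate to a single ratio \<open>\<alpha>(\<delta> n) / \<alpha>(n)\<close>; the
  indices below \<open>\<delta> n\<close> are negligible on average.\<close>

lemma slow_variation_averages:
  fixes f :: "nat \<Rightarrow> nat \<Rightarrow> real"
  assumes nonneg: "\<And>n i. 0 \<le> f n i"
    and tail: "\<And>\<delta>. 0 < \<delta> \<Longrightarrow> \<delta> \<le> 1 \<Longrightarrow>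
        \<exists>u. u \<longlonglongrightarrow> 0 \<and> eventually (\<lambda>n. \<forall>i\<in>{1..n}. real i \<ge> \<delta> * real n \<longrightarrow> f n i \<le> u n) sequentially"
    and head: "\<And>\<epsilon>. 0 < \<epsilon> \<Longrightarrow> \<exists>\<delta>. 0 < \<delta> \<and> \<delta> \<le> 1 \<and>
        eventually (\<lambda>n. (1 / real n) * (\<Sum>i | i \<in> {1..n} \<and> real i < \<delta> * real n. f n i) \<le> \<epsilon>) sequentially"
  shows "(\<lambda>n. (1 / real n) * (\<Sum>i=1..n. f n i)) \<longlonglongrightarrow> 0"
proof (rule LIMSEQ_I)
  fix \<epsilon> :: real assume "\<epsilon> > 0"
  then obtain \<delta> where \<delta>: "0 < \<delta>" "\<delta> \<le> 1" and hd:
    "eventually (\<lambda>n. (1 / real n) * (\<Sum>i | i \<in> {1..n} \<and> real i < \<delta> * real n. f n i) \<le> \<epsilon> / 2) sequentially"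
    using head[of "\<epsilon> / 2"] by auto
  obtain u where u: "u \<longlonglongrightarrow> 0"
    and tl: "eventually (\<lambda>n. \<forall>i\<in>{1..n}. real i \<ge> \<delta> * real n \<longrightarrow> f n i \<le> u n) sequentially"
    using tail[OF \<delta>] by blast
  have "eventually (\<lambda>n. u n < \<epsilon> / 2) sequentially"
    using order_tendstoD(2)[OF u, of "\<epsilon>/2"] \<open>\<epsilon> > 0\<close> by simp
  with hd tl eventually_ge_at_top[of "1::nat"]
  have "eventually (\<lambda>n. norm ((1 / real n) * (\<Sum>i=1..n. f n i)) < \<epsilon>) sequentially"
  proof eventually_elim
    case (elim n)
    let ?H = "{i. i \<in> {1..n} \<and> real i < \<delta> * real n}" and ?T = "{i. i \<in> {1..n} \<and> \<not> real i < \<delta> * real n}"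
    have "u n \<ge> 0"
    proof -
      have "real n \<ge> \<delta> * real n" using \<delta> by (simp add: mult_left_le_one_le)
      then show ?thesis using elim nonneg[of n n] by (metis atLeastAtMost_iff order_refl order_trans)
    qed
    have split: "(\<Sum>i=1..n. f n i) = (\<Sum>i\<in>?H. f n i) + (\<Sum>i\<in>?T. f n i)"
      by (subst sum.union_disjoint[symmetric]) (auto intro: sum.cong)
    have "(\<Sum>i\<in>?T. f n i) \<le> (\<Sum>i\<in>?T. u n)" using elim by (intro sum_mono) auto
    also have "\<dots> \<le> real n * u n"
    proof -
      have "card ?T \<le> card {1..n}" by (intro card_mono) auto
      then show ?thesis using \<open>u n \<ge> 0\<close> by (simp add: mult_right_mono)
    qed
    finally have "(1 / real n) * (\<Sum>i\<in>?T. f n i) \<le> u n" using elim by (simp add: field_simps)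
    then have "(1 / real n) * (\<Sum>i=1..n. f n i) < \<epsilon>"
      unfolding split distrib_left using elim by linarith
    then show ?case using nonneg by (simp add: sum_nonneg abs_mult)
  qed
  then show "\<exists>n0. \<forall>n\<ge>n0. norm ((1 / real n) * (\<Sum>i=1..n. f n i) - 0) < \<epsilon>"
    by (simp add: eventually_sequentially)
qed

lemma slow_variation_ratio:
  fixes \<alpha> :: "real \<Rightarrow> real"
  assumes "((\<lambda>t. \<alpha> (t * s) / \<alpha> t) \<longlongrightarrow> 1) at_top"
  shows "(\<lambda>n. \<bar>\<alpha> (real n * s) / \<alpha> (real n) - 1\<bar>) \<longlonglongrightarrow> 0"
proof -
  have "((\<lambda>t. \<bar>\<alpha> (t * s) / \<alpha> t - 1\<bar>) \<longlongrightarrow> \<bar>1 - 1\<bar>) at_top"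
    by (intro tendsto_intros assms)
  then show ?thesis
    using filterlim_compose[OF _ filterlim_real_sequentially] by fastforce
qed

text \<open>Here the ratios lie in \<open>[0,1]\<close>, so the indices below \<open>\<delta> n\<close> contribute at most \<open>\<delta>\<close>.\<close>

lemma nondecreasing_weights:
  fixes \<alpha> :: "real \<Rightarrow> real"
  assumes pos: "\<And>t. t > 0 \<Longrightarrow> \<alpha> t > 0" and mono: "mono_on {0<..} \<alpha>"
    and slow: "\<And>s. s \<in> {0<..1} \<Longrightarrow> ((\<lambda>t. \<alpha> (t * s) / \<alpha> t) \<longlongrightarrow> 1) at_top"
  shows "(\<lambda>n. (1 / real n) * (\<Sum>i=1..n. \<bar>\<alpha> (real i) / \<alpha> (real n) - 1\<bar>)) \<longlonglongrightarrow> 0"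
proof (rule slow_variation_averages)
  fix \<delta> :: real assume \<delta>: "0 < \<delta>" "\<delta> \<le> 1"
  have "\<bar>\<alpha> (real i) / \<alpha> (real n) - 1\<bar> \<le> \<bar>\<alpha> (real n * \<delta>) / \<alpha> (real n) - 1\<bar>"
    if "i \<in> {1..n}" "real i \<ge> \<delta> * real n" for i n
  proof -
    have "\<alpha> (real n * \<delta>) \<le> \<alpha> (real i)" "\<alpha> (real i) \<le> \<alpha> (real n)"
      using that \<delta> by (auto intro!: mono_onD[OF mono] simp: mult.commute)
    moreover have "\<alpha> (real n) > 0" using that pos by auto
    ultimately have "\<alpha> (real n * \<delta>) / \<alpha> (real n) \<le> \<alpha> (real i) / \<alpha> (real n)"
        "\<alpha> (real i) / \<alpha> (real n) \<le> 1"
      by (auto simp: divide_right_mono)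
    then show ?thesis by linarith
  qed
  then show "\<exists>u. u \<longlonglongrightarrow> 0 \<and> eventually (\<lambda>n. \<forall>i\<in>{1..n}. real i \<ge> \<delta> * real n \<longrightarrow>
      \<bar>\<alpha> (real i) / \<alpha> (real n) - 1\<bar> \<le> u n) sequentially"
    using slow_variation_ratio[OF slow] \<delta>
    by (intro exI[of _ "\<lambda>n. \<bar>\<alpha> (real n * \<delta>) / \<alpha> (real n) - 1\<bar>"]) auto
next
  fix \<epsilon> :: real assume \<epsilon>: "0 < \<epsilon>"
  define \<delta> where "\<delta> = min \<epsilon> 1"
  have "(1 / real n) * (\<Sum>i | i \<in> {1..n} \<and> real i < \<delta> * real n. \<bar>\<alpha> (real i) / \<alpha> (real n) - 1\<bar>) \<le> \<epsilon>"
    if n: "n \<ge> 1" for n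
  proof -
    let ?H = "{i. i \<in> {1..n} \<and> real i < \<delta> * real n}"
    have "\<bar>\<alpha> (real i) / \<alpha> (real n) - 1\<bar> \<le> 1" if "i \<in> ?H" for i
    proof -
      have "\<alpha> (real i) \<le> \<alpha> (real n)" "\<alpha> (real i) > 0" "\<alpha> (real n) > 0"
        using that n by (auto intro!: mono_onD[OF mono] pos)
      then have "\<alpha> (real i) / \<alpha> (real n) \<le> 1" "0 \<le> \<alpha> (real i) / \<alpha> (real n)" by auto
      then show ?thesis by linarith
    qed
    then have "(\<Sum>i\<in>?H. \<bar>\<alpha> (real i) / \<alpha> (real n) - 1\<bar>) \<le> real (card ?H)"
      using sum_bounded_above[of ?H _ "1::real"] by simp
    also have "\<dots> \<le> \<epsilon> * real n"
    proof -
      have "?H \<subseteq> {1..nat \<lfloor>\<delta> * real n\<rfloor>}" by (auto simp: le_nat_iff le_floor_iff)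
      then have "card ?H \<le> nat \<lfloor>\<delta> * real n\<rfloor>" using card_mono[of "{1..nat \<lfloor>\<delta> * real n\<rfloor>}" ?H] by simp
      moreover have "\<delta> * real n \<ge> 0" using \<epsilon> by (simp add: \<delta>_def)
      ultimately have "real (card ?H) \<le> \<delta> * real n" by linarith
      then show ?thesis unfolding \<delta>_def using mult_right_mono[of "min \<epsilon> 1" \<epsilon> "real n"] by linarith
    qed
    finally show ?thesis using n by (simp add: field_simps)
  qed
  then have "eventually (\<lambda>n. (1 / real n) *
      (\<Sum>i | i \<in> {1..n} \<and> real i < \<delta> * real n. \<bar>\<alpha> (real i) / \<alpha> (real n) - 1\<bar>) \<le> \<epsilon>) sequentially"
    by (rule eventually_sequentiallyI)
  moreover have "0 < \<delta>" "\<delta> \<le> 1" using \<epsilon> by (auto simp: \<delta>_def)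
  ultimately show "\<exists>\<delta>. 0 < \<delta> \<and> \<delta> \<le> 1 \<and> eventually (\<lambda>n. (1 / real n) *
      (\<Sum>i | i \<in> {1..n} \<and> real i < \<delta> * real n. \<bar>\<alpha> (real i) / \<alpha> (real n) - 1\<bar>) \<le> \<epsilon>) sequentially"
    by blast
qed simp

text \<open>Now the ratios may be large near \<open>0\<close>. For \<open>s\<close> in the interval \<open>](i-1)/n, i/n]\<close> monotonicity gives
  \<open>\<alpha>(i)/\<alpha>(n) - 1 \<le> \<alpha>(n s)/\<alpha>(n) - 1 \<le> b(s)\<close>, so the average over \<open>i < \<delta> n\<close> is a lower Riemann-type sum, at
  most the integral of \<open>b\<close> over \<open>]0,\<delta>]\<close>, which is small with \<open>\<delta>\<close>.\<close>

lemma nonincreasing_weights: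
  fixes \<alpha> b :: "real \<Rightarrow> real"
  assumes pos: "\<And>t. t > 0 \<Longrightarrow> \<alpha> t > 0" and anti: "antimono_on {0<..} \<alpha>"
    and slow: "\<And>s. s \<in> {0<..1} \<Longrightarrow> ((\<lambda>t. \<alpha> (t * s) / \<alpha> t) \<longlongrightarrow> 1) at_top"
    and b_nonneg: "\<And>s. s \<in> {0..1} \<Longrightarrow> 0 \<le> b s"
    and b_meas: "set_borel_measurable lebesgue {0..1} b"
    and b_fin: "(\<integral>\<^sup>+s\<in>{0..1}. ennreal (b s) \<partial>lebesgue) < \<infinity>"
    and dom: "\<And>s t. s \<in> {0<..1} \<Longrightarrow> t > 0 \<Longrightarrow> \<alpha> (t * s) / \<alpha> t - 1 \<le> b s"
  shows "(\<lambda>n. (1 / real n) * (\<Sum>i=1..n. \<bar>\<alpha> (real i) / \<alpha> (real n) - 1\<bar>)) \<longlonglongrightarrow> 0"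
proof (rule slow_variation_averages)
  fix \<delta> :: real assume \<delta>: "0 < \<delta>" "\<delta> \<le> 1"
  have "\<bar>\<alpha> (real i) / \<alpha> (real n) - 1\<bar> \<le> \<bar>\<alpha> (real n * \<delta>) / \<alpha> (real n) - 1\<bar>"
    if "i \<in> {1..n}" "real i \<ge> \<delta> * real n" for i n
  proof -
    have "\<alpha> (real i) \<le> \<alpha> (real n * \<delta>)" "\<alpha> (real n) \<le> \<alpha> (real i)"
      using that \<delta> by (auto intro!: monotone_onD[OF anti] simp: mult.commute)
    moreover have "\<alpha> (real n) > 0" using that pos by auto
    ultimately have "\<alpha> (real i) / \<alpha> (real n) \<le> \<alpha> (real n * \<delta>) / \<alpha> (real n)"
        "1 \<le> \<alpha> (real i) / \<alpha> (real n)"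
      by (auto simp: divide_right_mono)
    then show ?thesis by linarith
  qed
  then show "\<exists>u. u \<longlonglongrightarrow> 0 \<and> eventually (\<lambda>n. \<forall>i\<in>{1..n}. real i \<ge> \<delta> * real n \<longrightarrow>
      \<bar>\<alpha> (real i) / \<alpha> (real n) - 1\<bar> \<le> u n) sequentially"
    using slow_variation_ratio[OF slow] \<delta>
    by (intro exI[of _ "\<lambda>n. \<bar>\<alpha> (real n * \<delta>) / \<alpha> (real n) - 1\<bar>"]) auto
next
  fix \<epsilon> :: real assume \<epsilon>: "0 < \<epsilon>"
  define f where "f s = indicator {0..1} s * b s" for s :: real
  have f_nonneg: "0 \<le> f s" for s using b_nonneg by (auto simp: f_def indicator_def)
  have f_meas[measurable]: "f \<in> borel_measurable lebesgue"
    using b_meas by (simp add: set_borel_measurable_def f_def[abs_def])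
  have f_int: "integrable lebesgue f"
  proof (rule integrableI_nonneg)
    have "(\<integral>\<^sup>+s. ennreal (f s) \<partial>lebesgue) = (\<integral>\<^sup>+s\<in>{0..1}. ennreal (b s) \<partial>lebesgue)"
      by (intro nn_integral_cong) (auto simp: f_def indicator_def)
    then show "(\<integral>\<^sup>+s. ennreal (f s) \<partial>lebesgue) < \<infinity>" using b_fin by simp
  qed (use f_nonneg in auto)
  have "(\<lambda>k. \<integral>s. indicator {0<..1 / real (Suc k)} s * f s \<partial>lebesgue) \<longlonglongrightarrow> (\<integral>s. 0 \<partial>(lebesgue :: real measure))"
  proof (rule integral_dominated_convergence[where w = f])
    show "AE s in lebesgue. (\<lambda>k. indicator {0<..1 / real (Suc k)} s * f s) \<longlonglongrightarrow> 0"
    proof (intro AE_I2)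
      fix s :: real
      have "eventually (\<lambda>k. indicator {0<..1 / real (Suc k)} s * f s = 0) sequentially"
      proof (cases "s > 0")
        case True
        have "eventually (\<lambda>k. 1 / real (Suc k) < s) sequentially"
          using order_tendstoD(2)[OF LIMSEQ_Suc[OF lim_1_over_n] True] by simp
        then show ?thesis by eventually_elim auto
      qed auto
      then show "(\<lambda>k. indicator {0<..1 / real (Suc k)} s * f s) \<longlonglongrightarrow> 0"
        by (rule tendsto_eventually)
    qed
    show "(\<lambda>s. indicator {0<..1 / real (Suc k)} s * f s) \<in> borel_measurable lebesgue" for k
      by (intro borel_measurable_times borel_measurable_indicator f_meas) simp
  qed (use f_int f_nonneg in \<open>auto simp: indicator_def\<close>)
  then have "eventually (\<lambda>k. (\<integral>s. indicator {0<..1 / real (Suc k)} s * f s \<partial>lebesgue) < \<epsilon>) sequentially"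
    using \<epsilon> by (intro order_tendstoD(2)) auto
  then obtain k where k: "(\<integral>s. indicator {0<..1 / real (Suc k)} s * f s \<partial>lebesgue) < \<epsilon>"
    by (auto simp: eventually_sequentially)
  define \<delta> where "\<delta> = 1 / real (Suc k)"
  have \<delta>: "0 < \<delta>" "\<delta> \<le> 1" by (auto simp: \<delta>_def)
  have "(1 / real n) * (\<Sum>i | i \<in> {1..n} \<and> real i < \<delta> * real n. \<bar>\<alpha> (real i) / \<alpha> (real n) - 1\<bar>) \<le> \<epsilon>"
    if n: "n \<ge> 1" for n
  proof -
    let ?H = "{i. i \<in> {1..n} \<and> real i < \<delta> * real n}"
    define J where "J i = {(real i - 1) / real n<..real i / real n}" for i
    define c where "c i = \<bar>\<alpha> (real i) / \<alpha> (real n) - 1\<bar>" for i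
    have c_le: "c i \<le> f s" "s \<in> {0<..\<delta>}" if i: "i \<in> ?H" and s: "s \<in> J i" for i s
    proof -
      have ns: "0 < real n * s" "real n * s \<le> real i" "0 < s" "s \<le> real i / real n"
      proof -
        have "0 \<le> (real i - 1) / real n" using i by auto
        then show "0 < s" using s by (auto simp: J_def)
        then show "0 < real n * s" using n by simp
        show "s \<le> real i / real n" using s by (auto simp: J_def)
        then show "real n * s \<le> real i" using n by (simp add: field_simps)
      qed
      have "real i / real n < \<delta>" using i n by (simp add: field_simps)
      with ns show s\<delta>: "s \<in> {0<..\<delta>}" by auto
      have "\<alpha> (real i) \<le> \<alpha> (real n * s)" "\<alpha> (real n) \<le> \<alpha> (real i)"
        using ns i by (auto intro!: monotone_onD[OF anti])
      moreover have "\<alpha> (real n) > 0" using n pos by auto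
      ultimately have "\<alpha> (real i) / \<alpha> (real n) \<le> \<alpha> (real n * s) / \<alpha> (real n)"
          "1 \<le> \<alpha> (real i) / \<alpha> (real n)"
        by (auto simp: divide_right_mono)
      moreover have "\<alpha> (real n * s) / \<alpha> (real n) - 1 \<le> b s"
        using s\<delta> \<delta> n by (intro dom) auto
      moreover have "f s = b s" using s\<delta> \<delta> by (auto simp: f_def)
      ultimately show "c i \<le> f s" unfolding c_def by linarith
    qed
    have disj: "i = j" if "s \<in> J i" "s \<in> J j" for s i j
    proof -
      have "real i - 1 < s * real n" "s * real n \<le> real i" "real j - 1 < s * real n" "s * real n \<le> real j"
        using that n by (auto simp: J_def field_simps)
      then show ?thesis by linarith
    qed
    have J_le: "(real i - 1) / real n \<le> real i / real n" for i
      by (intro divide_right_mono) auto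
    have J_int: "integrable lebesgue (\<lambda>s. indicator (J i) s * c i)" for i
      using J_le[of i] by (intro integrable_mult_left integrable_real_indicator) (auto simp: J_def)
    have "(1 / real n) * (\<Sum>i\<in>?H. c i) = (\<Sum>i\<in>?H. \<integral>s. indicator (J i) s * c i \<partial>lebesgue)"
      unfolding sum_distrib_left
    proof (intro sum.cong refl)
      fix i assume "i \<in> ?H"
      show "(1 / real n) * c i = (\<integral>s. indicator (J i) s * c i \<partial>lebesgue)"
        using J_le[of i] by (simp add: J_def diff_divide_distrib)
    qed
    also have "\<dots> = (\<integral>s. (\<Sum>i\<in>?H. indicator (J i) s * c i) \<partial>lebesgue)"
      by (rule Bochner_Integration.integral_sum[symmetric]) (rule J_int)
    also have "\<dots> \<le> (\<integral>s. indicator {0<..\<delta>} s * f s \<partial>lebesgue)"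
    proof (rule integral_mono)
      show "integrable lebesgue (\<lambda>s. \<Sum>i\<in>?H. indicator (J i) s * c i)"
        by (intro Bochner_Integration.integrable_sum J_int)
      show "integrable lebesgue (\<lambda>s. indicator {0<..\<delta>} s * f s)"
        using integrable_mult_indicator[OF _ f_int, of "{0<..\<delta>}"] by simp
      show "(\<Sum>i\<in>?H. indicator (J i) s * c i) \<le> indicator {0<..\<delta>} s * f s" for s
      proof (cases "\<exists>i\<in>?H. s \<in> J i")
        case True
        then obtain i where i: "i \<in> ?H" "s \<in> J i" by blast
        have "(\<Sum>j\<in>?H. indicator (J j) s * c j) = (\<Sum>j\<in>?H. if j = i then c i else 0)"
          using i disj by (intro sum.cong) (auto simp: indicator_def)
        also have "\<dots> = c i" using i by (subst sum.delta) auto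
        finally show ?thesis using c_le[OF i] by simp
      next
        case False
        then have "(\<Sum>j\<in>?H. indicator (J j) s * c j) = 0"
          by (intro sum.neutral) auto
        then show ?thesis using f_nonneg by simp
      qed
    qed
    finally show ?thesis using k unfolding c_def \<delta>_def by simp
  qed
  then have "eventually (\<lambda>n. (1 / real n) *
      (\<Sum>i | i \<in> {1..n} \<and> real i < \<delta> * real n. \<bar>\<alpha> (real i) / \<alpha> (real n) - 1\<bar>) \<le> \<epsilon>) sequentially"
    by (rule eventually_sequentiallyI)
  with \<delta> show "\<exists>\<delta>. 0 < \<delta> \<and> \<delta> \<le> 1 \<and> eventually (\<lambda>n. (1 / real n) *
      (\<Sum>i | i \<in> {1..n} \<and> real i < \<delta> * real n. \<bar>\<alpha> (real i) / \<alpha> (real n) - 1\<bar>) \<le> \<epsilon>) sequentially"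
    by blast
qed simp

text \<open>The initial weight \<open>1\<close> of each point is spread into the measure, so that the matrix of the walk
  is \<open>limit_kernel\<close> at this vector without any error term.\<close>

definition weighted_occupation ::
  "(nat \<Rightarrow> real) \<Rightarrow> (nat \<Rightarrow> 'w \<Rightarrow> 'e::finite) \<Rightarrow> nat \<Rightarrow> 'w \<Rightarrow> real ^ 'e" where
  "weighted_occupation a X n \<omega> =
     (\<chi> y. (1 + (\<Sum>i=1..n. a i * of_bool (X i \<omega> = y))) / (real CARD('e) + (\<Sum>i=1..n. a i)))"

lemma sum_of_bool_eq_UNIV: "(\<Sum>y\<in>UNIV. of_bool (x = y)) = (1::real)" for x :: "'e::finite"
  by simp

lemma occupation_nth:
  "occupation X n \<omega> $ y = (1 / real n) * (\<Sum>i=1..n. of_bool (X i \<omega> = y))"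
proof -
  have "axis (X i \<omega>) (1::real) $ y = of_bool (X i \<omega> = y)" for i
    by (auto simp: axis_def)
  then show ?thesis by (simp only: occupation_def vector_scaleR_component sum_component real_scaleR_def)
qed

lemma weighted_occupation_in_prob_vecs:
  fixes X :: "nat \<Rightarrow> 'w \<Rightarrow> 'e::finite"
  assumes "\<And>n. n \<ge> 1 \<Longrightarrow> a n > 0"
  shows "weighted_occupation a X n \<omega> \<in> prob_vecs"
proof -
  have r: "(\<Sum>i=1..n. a i) \<ge> 0" using assms by (intro sum_nonneg) (auto intro: less_imp_le)
  have "(\<Sum>y\<in>UNIV. \<Sum>i=1..n. a i * of_bool (X i \<omega> = y)) = (\<Sum>i=1..n. a i)"
    by (subst sum.swap) (simp add: sum_distrib_left[symmetric] sum_of_bool_eq_UNIV)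
  moreover have "0 \<le> (\<Sum>i=1..n. a i * of_bool (X i \<omega> = y))" for y
    using assms by (intro sum_nonneg) (auto intro: less_imp_le)
  moreover have "real CARD('e) + (\<Sum>i=1..n. a i) > 0" using r by (simp add: add_pos_nonneg)
  ultimately show ?thesis
    by (simp add: prob_vecs_def weighted_occupation_def sum_divide_distrib[symmetric] sum.distrib)
qed

lemma vrrw_matrix_eq_limit_kernel:
  fixes X :: "nat \<Rightarrow> 'w \<Rightarrow> 'e::finite"
  assumes "\<And>n. n \<ge> 1 \<Longrightarrow> a n > 0"
  shows "vrrw_matrix U a X n \<omega> = limit_kernel U (weighted_occupation a X n \<omega>)"
proof -
  define D where "D = real CARD('e) + (\<Sum>i=1..n. a i)"
  have "(\<Sum>i=1..n. a i) \<ge> 0" using assms by (intro sum_nonneg) (auto intro: less_imp_le)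
  then have "D > 0" by (simp add: D_def add_pos_nonneg)
  then show ?thesis
    unfolding vrrw_matrix_def limit_kernel_def normalize_rows_def weighted_occupation_def
      D_def[symmetric]
    by (simp add: vec_eq_iff sum_divide_distrib[symmetric])
qed

lemma weighted_occupation_close:
  fixes X :: "nat \<Rightarrow> 'w \<Rightarrow> 'e::finite"
  assumes pos: "\<And>n. n \<ge> 1 \<Longrightarrow> a n > 0"
    and weights: "(\<lambda>n. \<Sum>i=1..n. \<bar>a i / (\<Sum>j=1..n. a j) - 1 / real n\<bar>) \<longlonglongrightarrow> 0"
  shows "(\<lambda>n. weighted_occupation a X n \<omega> - occupation X n \<omega>) \<longlonglongrightarrow> 0"
proof (rule vec_tendstoI)
  fix y :: 'e
  define r where "r n = (\<Sum>i=1..n. a i)" for n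
  define p where "p n = (\<Sum>i=1..n. \<bar>a i / r n - 1 / real n\<bar>)" for n
  define d where "d = real CARD('e)"
  have p0: "p \<longlonglongrightarrow> 0" using weights by (simp add: p_def[abs_def] r_def)
  have a1: "a 1 > 0" using pos by simp
  have d: "d \<ge> 1" unfolding d_def using zero_less_card_finite[where 'a = 'e] by linarith
  have "\<bar>(weighted_occupation a X n \<omega> - occupation X n \<omega>) $ y\<bar>
      \<le> d / a 1 * (p n + 1 / real n) + p n" if n: "n \<ge> 1" for n
  proof -
    define A where "A = (\<Sum>i=1..n. a i * of_bool (X i \<omega> = y))"
    have r: "r n > 0" unfolding r_def using n pos by (intro sum_pos) auto
    have a_nonneg: "0 \<le> a i" if "i \<in> {1..n}" for i using pos[of i] that by simp
    have A: "0 \<le> A" "A \<le> r n"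
      unfolding A_def r_def using a_nonneg
      by (auto intro!: sum_nonneg sum_mono simp: of_bool_def simp del: sum_mult_of_bool_eq)
    \<comment> \<open>The term \<open>i = 1\<close> of \<open>p n\<close> alone forces \<open>r n\<close> to infinity.\<close>
    have "\<bar>a 1 / r n - 1 / real n\<bar> \<le> p n"
      unfolding p_def using n by (intro member_le_sum) auto
    then have "a 1 / r n \<le> p n + 1 / real n" by linarith
    then have "d / a 1 * (a 1 / r n) \<le> d / a 1 * (p n + 1 / real n)"
      using a1 d by (intro mult_left_mono) auto
    then have r_inv: "d / r n \<le> d / a 1 * (p n + 1 / real n)" using a1 by simp
    have "A / r n - occupation X n \<omega> $ y = (\<Sum>i=1..n. (a i / r n - 1 / real n) * of_bool (X i \<omega> = y))"
      by (simp add: A_def occupation_nth sum_divide_distrib sum_distrib_left left_diff_distrib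
          sum_subtractf del: sum_mult_of_bool_eq sum_of_bool_eq sum_of_bool_mult_eq)
    also have "\<bar>\<dots>\<bar> \<le> (\<Sum>i=1..n. \<bar>(a i / r n - 1 / real n) * of_bool (X i \<omega> = y)\<bar>)" by (rule sum_abs)
    also have "\<dots> \<le> p n" unfolding p_def by (intro sum_mono) (auto simp: of_bool_def)
    finally have 1: "\<bar>A / r n - occupation X n \<omega> $ y\<bar> \<le> p n" .
    have "(1 + A) / (d + r n) - A / r n = (1 - d * (A / r n)) / (d + r n)"
      using r d by (simp add: field_simps)
    also have "\<bar>\<dots>\<bar> = \<bar>1 - d * (A / r n)\<bar> / (d + r n)" using r d by simp
    also have "\<dots> \<le> d / r n"
    proof (rule frac_le)
      have "0 \<le> A / r n" "A / r n \<le> 1" using A r by auto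
      then have "0 \<le> d * (A / r n)" "d * (A / r n) \<le> d * 1"
        using d by (auto intro!: mult_left_mono simp del: times_divide_eq_right)
      then show "\<bar>1 - d * (A / r n)\<bar> \<le> d" using d by linarith
    qed (use r d in auto)
    finally have "\<bar>(1 + A) / (d + r n) - A / r n\<bar> \<le> d / r n" .
    moreover have "weighted_occupation a X n \<omega> $ y = (1 + A) / (d + r n)"
      by (simp add: weighted_occupation_def A_def d_def r_def)
    ultimately show ?thesis using 1 r_inv unfolding vector_minus_component by linarith
  qed
  then have "eventually (\<lambda>n. norm ((weighted_occupation a X n \<omega> - occupation X n \<omega>) $ y)
      \<le> d / a 1 * (p n + 1 / real n) + p n) sequentially"
    by (intro eventually_sequentiallyI[of 1]) auto
  moreover have "(\<lambda>n. d / a 1 * (p n + 1 / real n) + p n) \<longlonglongrightarrow> 0"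
    using tendsto_add[OF tendsto_mult_left[OF tendsto_add[OF p0 lim_1_over_n], of "d / a 1"] p0]
    by simp
  ultimately have "(\<lambda>n. (weighted_occupation a X n \<omega> - occupation X n \<omega>) $ y) \<longlonglongrightarrow> 0"
    by (rule Lim_null_comparison)
  then show "(\<lambda>n. (weighted_occupation a X n \<omega> - occupation X n \<omega>) $ y) \<longlonglongrightarrow> (0 :: real ^ 'e) $ y"
    by simp
qed

section \<open>A strong law for bounded orthogonal variables\<close>

text \<open>With \<open>k = \<lfloor>sqrt n\<rfloor>\<close> the index \<open>n\<close> exceeds \<open>k\<^sup>2\<close> by at most \<open>2 k\<close>, which is negligible against \<open>k\<^sup>2\<close>.\<close>

lemma square_subsequence_fill:
  fixes S :: "nat \<Rightarrow> real"
  assumes step: "\<And>n. \<bar>S (Suc n) - S n\<bar> \<le> C"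
    and squares: "(\<lambda>k. S (k\<^sup>2) / real (k\<^sup>2)) \<longlonglongrightarrow> 0"
  shows "(\<lambda>n. S n / real n) \<longlonglongrightarrow> 0"
proof -
  define k where "k n = nat \<lfloor>sqrt (real n)\<rfloor>" for n
  have C: "C \<ge> 0" using step[of 0] by linarith
  have inc: "\<bar>S (m + j) - S m\<bar> \<le> C * real j" for m j
  proof (induction j)
    case (Suc j)
    then show ?case using step[of "m + j"] by (simp add: algebra_simps)
  qed simp
  have k_le: "real (k n) \<le> sqrt (real n)" and k_gt: "sqrt (real n) < real (k n) + 1" for n
  proof -
    have "\<lfloor>sqrt (real n)\<rfloor> \<ge> 0" by simp
    then have "real (k n) = of_int \<lfloor>sqrt (real n)\<rfloor>" by (simp add: k_def)
    then show "real (k n) \<le> sqrt (real n)" "sqrt (real n) < real (k n) + 1" by linarith+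
  qed
  have k_sq: "(k n)\<^sup>2 \<le> n" "n \<le> (k n)\<^sup>2 + 2 * k n" for n
  proof -
    have "(real (k n))\<^sup>2 \<le> (sqrt (real n))\<^sup>2" by (intro power_mono k_le) auto
    then have "real ((k n)\<^sup>2) \<le> real n" by simp
    then show "(k n)\<^sup>2 \<le> n" by linarith
    have "(sqrt (real n))\<^sup>2 < (real (k n) + 1)\<^sup>2" by (intro power_strict_mono k_gt) auto
    then have "real n < real ((k n)\<^sup>2 + 2 * k n + 1)" by (simp add: power2_eq_square algebra_simps)
    then show "n \<le> (k n)\<^sup>2 + 2 * k n" by linarith
  qed
  have k_top: "filterlim k at_top sequentially"
  proof -
    have "filterlim (\<lambda>n. sqrt (real n)) at_top sequentially"
      by (rule filterlim_compose[OF sqrt_at_top filterlim_real_sequentially])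
    then show ?thesis
      unfolding k_def
      by (intro filterlim_compose[OF filterlim_nat_sequentially] filterlim_compose[OF filterlim_floor_sequentially])
  qed
  have "\<bar>S n / real n\<bar> \<le> \<bar>S ((k n)\<^sup>2) / real ((k n)\<^sup>2)\<bar> + 2 * C / real (k n)" if n: "n \<ge> 1" for n
  proof -
    have k1: "k n \<ge> 1" unfolding k_def using n by (simp add: le_nat_iff le_floor_iff)
    have "n = (k n)\<^sup>2 + (n - (k n)\<^sup>2)" using k_sq(1)[of n] by simp
    then have "\<bar>S n - S ((k n)\<^sup>2)\<bar> \<le> C * real (n - (k n)\<^sup>2)" using inc by metis
    also have "\<dots> \<le> C * real (2 * k n)" using C k_sq[of n] by (intro mult_left_mono) linarith+
    finally have "\<bar>S n\<bar> \<le> \<bar>S ((k n)\<^sup>2)\<bar> + C * real (2 * k n)" by linarith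
    moreover have "\<bar>S n / real n\<bar> \<le> \<bar>S n\<bar> / real ((k n)\<^sup>2)"
    proof -
      have "0 < real ((k n)\<^sup>2)" "real ((k n)\<^sup>2) \<le> real n"
        using k1 k_sq(1)[of n] by (simp_all only: of_nat_0_less_iff of_nat_le_iff) simp
      then show ?thesis unfolding abs_divide
        by (intro frac_le) linarith+
    qed
    ultimately have "\<bar>S n / real n\<bar> \<le> (\<bar>S ((k n)\<^sup>2)\<bar> + C * real (2 * k n)) / real ((k n)\<^sup>2)"
      by (meson divide_right_mono of_nat_0_le_iff order_trans)
    also have "\<dots> = \<bar>S ((k n)\<^sup>2) / real ((k n)\<^sup>2)\<bar> + 2 * C / real (k n)"
      using k1 by (simp add: add_divide_distrib power2_eq_square)
    finally show ?thesis .
  qed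
  then have "eventually (\<lambda>n. norm (S n / real n)
      \<le> \<bar>S ((k n)\<^sup>2) / real ((k n)\<^sup>2)\<bar> + 2 * C / real (k n)) sequentially"
    by (intro eventually_sequentiallyI[of 1]) auto
  moreover have "(\<lambda>n. \<bar>S ((k n)\<^sup>2) / real ((k n)\<^sup>2)\<bar> + 2 * C / real (k n)) \<longlonglongrightarrow> 0"
    using tendsto_add[OF tendsto_rabs[OF filterlim_compose[OF squares k_top]]
        filterlim_compose[OF lim_const_over_n[of "2 * C"] k_top]]
    by simp
  ultimately show ?thesis by (rule Lim_null_comparison)
qed

text \<open>By orthogonality the partial sums satisfy \<open>E S\<^sub>n\<^sup>2 \<le> C\<^sup>2 n\<close>. Along \<open>n = k\<^sup>2\<close> the second moments of \<open>S\<^sub>n / n\<close> are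
  summable, so \<open>S\<^sub>n / n\<close> tends to \<open>0\<close> almost surely there, and boundedness fills the gaps between
  squares.\<close>

proposition (in prob_space) bounded_orthogonal_slln:
  fixes D :: "nat \<Rightarrow> 'a \<Rightarrow> real"
  assumes meas: "\<And>n. D n \<in> borel_measurable M"
    and bound: "\<And>n \<omega>. \<omega> \<in> space M \<Longrightarrow> \<bar>D n \<omega>\<bar> \<le> C"
    and orth: "\<And>i j. i < j \<Longrightarrow> expectation (\<lambda>\<omega>. D i \<omega> * D j \<omega>) = 0"
  shows "AE \<omega> in M. (\<lambda>n. (\<Sum>i<n. D i \<omega>) / real n) \<longlonglongrightarrow> 0"
proof -
  note [measurable] = meas
  define S where "S n \<omega> = (\<Sum>i<n. D i \<omega>)" for n \<omega>
  obtain \<omega>0 where "\<omega>0 \<in> space M" using not_empty by blast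
  then have C: "C \<ge> 0" using bound[of \<omega>0 0] by linarith
  have [measurable]: "S n \<in> borel_measurable M" for n unfolding S_def[abs_def] by measurable
  have DD_int: "integrable M (\<lambda>\<omega>. D i \<omega> * D j \<omega>)" for i j
  proof (rule integrable_const_bound[of _ "C * C"])
    show "AE \<omega> in M. norm (D i \<omega> * D j \<omega>) \<le> C * C"
      by (intro AE_I2) (auto simp: abs_mult intro!: mult_mono bound C)
  qed measurable
  have SD: "integrable M (\<lambda>\<omega>. S n \<omega> * D n \<omega>)" "expectation (\<lambda>\<omega>. S n \<omega> * D n \<omega>) = 0" for n
    unfolding S_def sum_distrib_right
    using DD_int orth by (auto simp: Bochner_Integration.integral_sum)
  have sq: "integrable M (\<lambda>\<omega>. (S n \<omega>)\<^sup>2) \<and> expectation (\<lambda>\<omega>. (S n \<omega>)\<^sup>2) \<le> C\<^sup>2 * real n" for n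
  proof (induction n)
    case 0
    show ?case by (simp add: S_def)
  next
    case (Suc n)
    have eq: "(S (Suc n) \<omega>)\<^sup>2 = (S n \<omega>)\<^sup>2 + 2 * (S n \<omega> * D n \<omega>) + D n \<omega> * D n \<omega>" for \<omega>
      by (simp add: S_def power2_eq_square algebra_simps)
    have "expectation (\<lambda>\<omega>. D n \<omega> * D n \<omega>) \<le> expectation (\<lambda>_. C\<^sup>2)"
    proof (rule integral_mono[OF DD_int])
      fix \<omega> assume "\<omega> \<in> space M"
      then have "\<bar>D n \<omega>\<bar> * \<bar>D n \<omega>\<bar> \<le> C * C" using bound C by (intro mult_mono) auto
      then show "D n \<omega> * D n \<omega> \<le> C\<^sup>2" by (simp add: power2_eq_square)
    qed simp
    then have "expectation (\<lambda>\<omega>. D n \<omega> * D n \<omega>) \<le> C\<^sup>2" by (simp add: prob_space)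
    then show ?case
      unfolding eq using Suc SD[of n] DD_int[of n n] by (simp add: distrib_left)
  qed
  have "AE \<omega> in M. (\<lambda>k. S (k\<^sup>2) \<omega> / real (k\<^sup>2)) \<longlonglongrightarrow> 0"
  proof -
    define Z where "Z k \<omega> = ennreal ((S (k\<^sup>2) \<omega> / real (k\<^sup>2))\<^sup>2)" for k \<omega>
    have [measurable]: "Z k \<in> borel_measurable M" for k unfolding Z_def[abs_def] by measurable
    have Z: "(\<integral>\<^sup>+\<omega>. Z k \<omega> \<partial>M) \<le> ennreal (C\<^sup>2 * (1 / real k ^ 2))" for k
    proof (cases "k = 0")
      case False
      have "(\<integral>\<^sup>+\<omega>. Z k \<omega> \<partial>M) = ennreal (expectation (\<lambda>\<omega>. (S (k\<^sup>2) \<omega> / real (k\<^sup>2))\<^sup>2))"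
        unfolding Z_def using sq[of "k\<^sup>2"] by (intro nn_integral_eq_integral) (auto simp: power_divide)
      also have "expectation (\<lambda>\<omega>. (S (k\<^sup>2) \<omega> / real (k\<^sup>2))\<^sup>2)
          = expectation (\<lambda>\<omega>. (S (k\<^sup>2) \<omega>)\<^sup>2) / (real (k\<^sup>2))\<^sup>2"
        by (simp add: power_divide)
      also have "\<dots> \<le> C\<^sup>2 * real (k\<^sup>2) / (real (k\<^sup>2))\<^sup>2"
        using sq[of "k\<^sup>2"] by (intro divide_right_mono) auto
      also have "\<dots> = C\<^sup>2 * (1 / real k ^ 2)" using False by (simp add: power2_eq_square)
      finally show ?thesis by (simp add: ennreal_leI)
    qed (simp add: Z_def)
    have "(\<integral>\<^sup>+\<omega>. (\<Sum>k. Z k \<omega>) \<partial>M) = (\<Sum>k. \<integral>\<^sup>+\<omega>. Z k \<omega> \<partial>M)"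
      by (rule nn_integral_suminf) measurable
    also have "\<dots> \<le> (\<Sum>k. ennreal (C\<^sup>2 * (1 / real k ^ 2)))"
      by (intro suminf_le Z) auto
    also have "\<dots> < \<infinity>"
    proof -
      have "summable (\<lambda>k. C\<^sup>2 * (1 / real k ^ 2))"
        using inverse_power_summable[of 2, where 'a = real]
        by (intro summable_mult) (simp add: inverse_eq_divide)
      then show ?thesis by (subst suminf_ennreal2) auto
    qed
    finally have "AE \<omega> in M. (\<Sum>k. Z k \<omega>) \<noteq> \<infinity>"
      by (intro nn_integral_PInf_AE) auto
    then show ?thesis
    proof eventually_elim
      case (elim \<omega>)
      then have "summable (\<lambda>k. (S (k\<^sup>2) \<omega> / real (k\<^sup>2))\<^sup>2)"
        unfolding Z_def by (intro summable_suminf_not_top) auto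
      then have "(\<lambda>k. (S (k\<^sup>2) \<omega> / real (k\<^sup>2))\<^sup>2) \<longlonglongrightarrow> 0" by (rule summable_LIMSEQ_zero)
      then have "(\<lambda>k. sqrt ((S (k\<^sup>2) \<omega> / real (k\<^sup>2))\<^sup>2)) \<longlonglongrightarrow> sqrt 0" by (rule tendsto_real_sqrt)
      then show ?case unfolding real_sqrt_abs real_sqrt_zero by (rule tendsto_rabs_zero_cancel)
    qed
  qed
  with AE_space show ?thesis
  proof eventually_elim
    case (elim \<omega>)
    have "(\<lambda>n. S n \<omega> / real n) \<longlonglongrightarrow> 0"
      by (rule square_subsequence_fill[where C = C]) (use elim bound in \<open>auto simp: S_def\<close>)
    then show ?case by (simp add: S_def)
  qed
qed

section \<open>Averaging along the walk\<close>

lemma compact_prob_vecs: "compact (prob_vecs :: (real ^ 'e::finite) set)"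
  unfolding compact_eq_bounded_closed
proof
  have "norm v \<le> 1" if "v \<in> prob_vecs" for v :: "real ^ 'e"
    using norm_le_l1_cart[of v] that by (simp add: prob_vecs_def)
  then show "bounded (prob_vecs :: (real ^ 'e) set)" by (auto simp: bounded_iff)
  have "closed ((\<Inter>x. {v :: real ^ 'e. 0 \<le> v $ x}) \<inter> {v. (\<Sum>x\<in>UNIV. v $ x) = 1})"
    by (intro closed_Int closed_INT ballI closed_Collect_le closed_Collect_eq continuous_intros)
  also have "(\<Inter>x. {v :: real ^ 'e. 0 \<le> v $ x}) \<inter> {v. (\<Sum>x\<in>UNIV. v $ x) = 1} = prob_vecs"
    by (auto simp: prob_vecs_def)
  finally show "closed (prob_vecs :: (real ^ 'e) set)" .
qed

lemma occupation_in_prob_vecs: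
  assumes "n \<ge> 1"
  shows "occupation X n \<omega> \<in> prob_vecs"
proof -
  have "(\<Sum>y\<in>UNIV. \<Sum>i=1..n. of_bool (X i \<omega> = y)) = real n"
    by (subst sum.swap) (simp only: sum_of_bool_eq_UNIV, simp)
  then show ?thesis
    using assms
    by (simp add: prob_vecs_def occupation_nth sum_nonneg sum_distrib_left[symmetric]
        sum_divide_distrib[symmetric] del: sum_of_bool_eq)
qed

lemma occupation_slow:
  assumes "1 \<le> m" "m \<le> n"
  shows "norm (occupation X n \<omega> - occupation X m \<omega>) \<le> 2 * (real n - real m) / real n"
proof -
  let ?T = "\<lambda>n. \<Sum>i=1..n. axis (X i \<omega>) (1::real)" and ?R = "\<Sum>i=Suc m..n. axis (X i \<omega>) (1::real)"
  have split: "?T n = ?T m + ?R"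
    using assms sum.ub_add_nat[of 1 m "\<lambda>i. axis (X i \<omega>) 1" "n - m"] by simp
  have "real m *\<^sub>R occupation X m \<omega> = ?T m" using assms by (simp add: occupation_def)
  then have "occupation X n \<omega> - occupation X m \<omega>
      = (1 / real n) *\<^sub>R (?R - (real n - real m) *\<^sub>R occupation X m \<omega>)"
    using assms unfolding occupation_def[of X n] split by (simp add: algebra_simps)
  moreover have "norm ?R \<le> real n - real m"
    using sum_norm_le[of "{Suc m..n}" "\<lambda>i. axis (X i \<omega>) (1::real)" "\<lambda>_. 1"] assms
    by (simp add: of_nat_diff)
  moreover have "norm (occupation X m \<omega>) \<le> 1"
    using norm_le_l1_cart[of "occupation X m \<omega>"] occupation_in_prob_vecs[OF assms(1), of X \<omega>]
    by (simp add: prob_vecs_def)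
  then have "norm ((real n - real m) *\<^sub>R occupation X m \<omega>) \<le> real n - real m"
    using assms by (simp add: mult_left_le)
  ultimately show ?thesis
    using assms norm_triangle_ineq4[of ?R "(real n - real m) *\<^sub>R occupation X m \<omega>"]
    by (simp add: divide_right_mono)
qed

lemma space_walk_sigma [simp]: "space (walk_sigma M X n) = space M"
  by (auto simp: walk_sigma_def space_measure_of_conv)

lemma measurable_walk_sigma:
  assumes "i \<in> {1..n}"
  shows "X i \<in> measurable (walk_sigma M X n) (count_space UNIV)"
proof (rule measurableI)
  fix A
  have "X i -` A \<inter> space M \<in> sigma_sets (space M) {X i -` A \<inter> space M | i A. i \<in> {1..n}}"
    using assms by (intro sigma_sets.Basic) auto
  then show "X i -` A \<inter> space (walk_sigma M X n) \<in> sets (walk_sigma M X n)"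
    unfolding walk_sigma_def by (subst sets_measure_of) (auto simp: space_measure_of_conv)
qed simp

text \<open>As the walk takes finitely many values, a function of the first \<open>n\<close> steps factors through a
  finite discrete space. This settles measurability with respect to the past of everything below,
  without any regularity of the functions applied to the path.\<close>

lemma path_function_measurable:
  fixes X :: "nat \<Rightarrow> 'w \<Rightarrow> 'e::finite" and Z :: "'w \<Rightarrow> real"
  assumes path: "\<And>\<omega> \<omega>'. \<omega> \<in> space M \<Longrightarrow> \<omega>' \<in> space M \<Longrightarrow> (\<And>i. i \<in> {1..n} \<Longrightarrow> X i \<omega> = X i \<omega>') \<Longrightarrow> Z \<omega> = Z \<omega>'"
  shows "Z \<in> borel_measurable (walk_sigma M X n)"
proof -
  define p where "p \<omega> = (\<lambda>i\<in>{1..n}. X i \<omega>)" for \<omega>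
  define h where "h q = Z (SOME \<omega>. \<omega> \<in> space M \<and> p \<omega> = q)" for q
  have "p \<in> measurable (walk_sigma M X n) (PiM {1..n} (\<lambda>_. count_space UNIV))"
    unfolding p_def by (intro measurable_restrict measurable_walk_sigma)
  also have "PiM {1..n} (\<lambda>_. count_space UNIV) = count_space (PiE {1..n} (\<lambda>_. UNIV :: 'e set))"
    by (rule count_space_PiM_finite) auto
  finally have "p \<in> measurable (walk_sigma M X n) (count_space (PiE {1..n} (\<lambda>_. UNIV)))" .
  then have "(\<lambda>\<omega>. h (p \<omega>)) \<in> borel_measurable (walk_sigma M X n)"
    by (rule measurable_compose) simp
  moreover have "h (p \<omega>) = Z \<omega>" if \<omega>: "\<omega> \<in> space M" for \<omega>
  proof -
    define \<omega>' where "\<omega>' = (SOME \<omega>'. \<omega>' \<in> space M \<and> p \<omega>' = p \<omega>)"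
    have "\<omega>' \<in> space M \<and> p \<omega>' = p \<omega>"
      unfolding \<omega>'_def by (rule someI[of _ \<omega>]) (simp add: \<omega>)
    then have "Z \<omega>' = Z \<omega>"
      using \<omega> by (intro path) (auto simp: p_def fun_eq_iff restrict_def split: if_splits)
    then show ?thesis by (simp add: h_def \<omega>'_def)
  qed
  ultimately show ?thesis
    using measurable_cong[of "walk_sigma M X n" "\<lambda>\<omega>. h (p \<omega>)" Z] by simp
qed

lemma weighted_occupation_path:
  assumes "\<And>i. i \<in> {1..n} \<Longrightarrow> X i \<omega> = X i \<omega>'"
  shows "weighted_occupation a X n \<omega> = weighted_occupation a X n \<omega>'"
  unfolding weighted_occupation_def using assms by (auto simp: vec_eq_iff intro!: arg_cong2[where f = "(/)"] sum.cong)

text \<open>The transition rule in integrated form: it is the only place where conditional expectations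
  are used.\<close>

lemma vrrw_increment_orthogonal:
  fixes U :: "real ^ 'e::finite ^ 'e" and X :: "nat \<Rightarrow> 'w \<Rightarrow> 'e" and z :: 'e
  assumes walk: "vrrw M U a X" and a_pos: "\<And>n. n \<ge> 1 \<Longrightarrow> a n > 0" and U_pos: "\<forall>x y. U $ x $ y > 0"
    and n: "n \<ge> 1" and Z_meas: "Z \<in> borel_measurable (walk_sigma M X n)"
    and Z_bound: "\<And>\<omega>. \<omega> \<in> space M \<Longrightarrow> \<bar>Z \<omega>\<bar> \<le> B"
  defines "\<Delta> \<equiv> \<lambda>\<omega>. of_bool (X (Suc n) \<omega> = z)
      - limit_kernel U (weighted_occupation a X n \<omega>) $ X n \<omega> $ z"
  shows "integrable M (\<lambda>\<omega>. Z \<omega> * \<Delta> \<omega>)" "(\<integral>\<omega>. Z \<omega> * \<Delta> \<omega> \<partial>M) = 0"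
proof -
  interpret prob_space M using walk by (simp add: vrrw_def)
  let ?F = "walk_sigma M X n"
  define I where "I = (indicator {\<omega> \<in> space M. X (Suc n) \<omega> = z} :: 'w \<Rightarrow> real)"
  define k where "k \<omega> = limit_kernel U (weighted_occupation a X n \<omega>) $ X n \<omega> $ z" for \<omega>
  have X_meas: "X i \<in> measurable M (count_space UNIV)" if "i \<ge> 1" for i
    using walk that by (simp add: vrrw_def)
  have sub: "subalgebra M ?F" by (rule subalgebra_walk_sigma[OF X_meas])
  interpret finite_measure_subalgebra M ?F
    by (intro finite_measure_subalgebra.intro finite_measure_subalgebra_axioms.intro sub) unfold_locales
  have cond: "AE \<omega> in M. real_cond_exp M ?F I \<omega> = k \<omega>"
    using walk n by (simp add: vrrw_def vrrw_matrix_eq_limit_kernel[OF a_pos] I_def k_def)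
  have [measurable]: "Z \<in> borel_measurable M" by (rule measurable_from_subalg[OF sub Z_meas])
  have "{\<omega> \<in> space M. X (Suc n) \<omega> = z} = X (Suc n) -` {z} \<inter> space M" by auto
  then have "{\<omega> \<in> space M. X (Suc n) \<omega> = z} \<in> sets M"
    using measurable_sets[OF X_meas[of "Suc n"], of "{z}"] by simp
  then have [measurable]: "I \<in> borel_measurable M" unfolding I_def by measurable
  have k_F: "k \<in> borel_measurable ?F"
  proof (rule path_function_measurable)
    fix \<omega> \<omega>' assume "\<And>i. i \<in> {1..n} \<Longrightarrow> X i \<omega> = X i \<omega>'"
    then show "k \<omega> = k \<omega>'"
      using weighted_occupation_path[of n X \<omega> \<omega>' a] n by (simp add: k_def)
  qed
  have [measurable]: "k \<in> borel_measurable M" by (rule measurable_from_subalg[OF sub k_F])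
  have k_bound: "\<bar>k \<omega>\<bar> \<le> 1" for \<omega>
  proof -
    let ?w = "weighted_occupation a X n \<omega>"
    have w: "?w \<in> prob_vecs" by (rule weighted_occupation_in_prob_vecs[OF a_pos])
    have "limit_kernel U ?w $ X n \<omega> \<in> prob_vecs"
      using limit_kernel_nonneg[OF U_pos w] limit_kernel_rows[OF U_pos w] by (simp add: prob_vecs_def)
    then show ?thesis
      using limit_kernel_nonneg[OF U_pos w] by (auto simp: k_def prob_vecs_le_1)
  qed
  have ZI: "integrable M (\<lambda>\<omega>. Z \<omega> * I \<omega>)"
  proof (rule integrable_const_bound[of _ B])
    show "AE \<omega> in M. norm (Z \<omega> * I \<omega>) \<le> B"
      using Z_bound by (intro AE_I2) (auto simp: I_def indicator_def intro: order_trans[OF abs_ge_zero])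
  qed measurable
  have Zk: "integrable M (\<lambda>\<omega>. Z \<omega> * k \<omega>)"
  proof (rule integrable_const_bound[of _ B])
    have "\<bar>Z \<omega>\<bar> * \<bar>k \<omega>\<bar> \<le> B * 1" if "\<omega> \<in> space M" for \<omega>
      using Z_bound[OF that] k_bound order_trans[OF abs_ge_zero Z_bound[OF that]] by (intro mult_mono) auto
    then show "AE \<omega> in M. norm (Z \<omega> * k \<omega>) \<le> B" by (intro AE_I2) (simp add: abs_mult)
  qed measurable
  have eq: "(\<integral>\<omega>. Z \<omega> * k \<omega> \<partial>M) = (\<integral>\<omega>. Z \<omega> * I \<omega> \<partial>M)"
  proof -
    have "(\<integral>\<omega>. Z \<omega> * k \<omega> \<partial>M) = (\<integral>\<omega>. Z \<omega> * real_cond_exp M ?F I \<omega> \<partial>M)"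
      using cond by (intro integral_cong_AE) auto
    also have "\<dots> = (\<integral>\<omega>. Z \<omega> * I \<omega> \<partial>M)"
      by (rule real_cond_exp_intg(2)[OF ZI Z_meas]) measurable
    finally show ?thesis .
  qed
  have \<Delta>: "Z \<omega> * \<Delta> \<omega> = Z \<omega> * I \<omega> - Z \<omega> * k \<omega>" if "\<omega> \<in> space M" for \<omega>
    using that by (simp add: \<Delta>_def I_def k_def indicator_def right_diff_distrib)
  show "integrable M (\<lambda>\<omega>. Z \<omega> * \<Delta> \<omega>)"
    using Bochner_Integration.integrable_diff[OF ZI Zk] by (simp add: \<Delta> cong: Bochner_Integration.integrable_cong)
  show "(\<integral>\<omega>. Z \<omega> * \<Delta> \<omega> \<partial>M) = 0"
    using Bochner_Integration.integral_diff[OF ZI Zk] eq by (simp add: \<Delta> cong: Bochner_Integration.integral_cong)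
qed

text \<open>\<open>g\<^sub>n(X\<^sub>n\<^sub>+\<^sub>1) - E(g\<^sub>n(X\<^sub>n\<^sub>+\<^sub>1) | F\<^sub>n)\<close> for the Poisson solution \<open>g\<^sub>n = G(w\<^sub>n)(\<cdot>,y)\<close>. The walk starts at time \<open>1\<close>, and
  the value \<open>0\<close> at \<open>n = 0\<close> allows sums over all \<open>i < n\<close>.\<close>

definition poisson_martingale_increment ::
  "real ^ 'e::finite ^ 'e \<Rightarrow> (nat \<Rightarrow> real) \<Rightarrow> (nat \<Rightarrow> 'w \<Rightarrow> 'e) \<Rightarrow> (real ^ 'e \<Rightarrow> real ^ 'e ^ 'e)
     \<Rightarrow> 'e \<Rightarrow> nat \<Rightarrow> 'w \<Rightarrow> real" where
  "poisson_martingale_increment U a X G y n \<omega> =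
     (if n = 0 then 0
      else G (weighted_occupation a X n \<omega>) $ X (Suc n) \<omega> $ y
        - (\<Sum>z\<in>UNIV. limit_kernel U (weighted_occupation a X n \<omega>) $ X n \<omega> $ z
             * G (weighted_occupation a X n \<omega>) $ z $ y))"

lemma poisson_martingale_increment_slln:
  fixes U :: "real ^ 'e::finite ^ 'e" and X :: "nat \<Rightarrow> 'w \<Rightarrow> 'e"
  assumes walk: "vrrw M U a X" and a_pos: "\<And>n. n \<ge> 1 \<Longrightarrow> a n > 0" and U_pos: "\<forall>x y. U $ x $ y > 0"
    and G_bound: "\<And>v x y. v \<in> prob_vecs \<Longrightarrow> \<bar>G v $ x $ y\<bar> \<le> B"
  shows "AE \<omega> in M. (\<lambda>n. (\<Sum>i<n. poisson_martingale_increment U a X G y i \<omega>) / real n) \<longlonglongrightarrow> 0"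
proof -
  interpret prob_space M using walk by (simp add: vrrw_def)
  let ?D = "poisson_martingale_increment U a X G y" and ?W = "weighted_occupation a X"
  have X_meas: "X i \<in> measurable M (count_space UNIV)" if "i \<ge> 1" for i
    using walk that by (simp add: vrrw_def)
  have sub: "subalgebra M (walk_sigma M X n)" for n by (rule subalgebra_walk_sigma[OF X_meas])
  have W: "?W n \<omega> \<in> prob_vecs" for n \<omega> by (rule weighted_occupation_in_prob_vecs[OF a_pos])
  have B: "B \<ge> 0" using order_trans[OF abs_ge_zero G_bound[OF W]] .
  have D_path: "?D i \<omega> = ?D i \<omega>'" if "\<And>l. l \<in> {1..Suc i} \<Longrightarrow> X l \<omega> = X l \<omega>'" for i \<omega> \<omega>'
    using weighted_occupation_path[of i X \<omega> \<omega>' a] that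
    by (auto simp: poisson_martingale_increment_def)
  have D_meas: "?D i \<in> borel_measurable M" for i
    using path_function_measurable[of M "Suc i" X "?D i"] D_path measurable_from_subalg[OF sub] by blast
  have D_bound: "\<bar>?D i \<omega>\<bar> \<le> 2 * B" for i \<omega>
  proof (cases "i = 0")
    case False
    let ?K = "limit_kernel U (?W i \<omega>) $ X i \<omega>"
    have "\<bar>\<Sum>z\<in>UNIV. ?K $ z * G (?W i \<omega>) $ z $ y\<bar> \<le> (\<Sum>z\<in>UNIV. \<bar>?K $ z * G (?W i \<omega>) $ z $ y\<bar>)"
      by (rule sum_abs)
    also have "\<dots> \<le> (\<Sum>z\<in>UNIV. ?K $ z * B)"
      using limit_kernel_nonneg[OF U_pos W] G_bound[OF W]
      by (intro sum_mono) (auto simp: abs_mult intro!: mult_left_mono)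
    also have "\<dots> = B" by (simp add: sum_distrib_right[symmetric] limit_kernel_rows[OF U_pos W])
    finally have "\<bar>\<Sum>z\<in>UNIV. ?K $ z * G (?W i \<omega>) $ z $ y\<bar> \<le> B" .
    moreover have "\<bar>G (?W i \<omega>) $ X (Suc i) \<omega> $ y\<bar> \<le> B" by (rule G_bound[OF W])
    ultimately show ?thesis using False by (simp add: poisson_martingale_increment_def)
  qed (use B in \<open>simp add: poisson_martingale_increment_def\<close>)
  have orth: "expectation (\<lambda>\<omega>. ?D i \<omega> * ?D j \<omega>) = 0" if ij: "i < j" for i j
  proof -
    define Z where "Z z \<omega> = ?D i \<omega> * G (?W j \<omega>) $ z $ y" for z \<omega>
    define \<Delta> where "\<Delta> z \<omega> = of_bool (X (Suc j) \<omega> = z) - limit_kernel U (?W j \<omega>) $ X j \<omega> $ z" for z \<omega>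
    have "Z z \<in> borel_measurable (walk_sigma M X j)" for z
    proof (rule path_function_measurable)
      fix \<omega> \<omega>' assume *: "\<And>l. l \<in> {1..j} \<Longrightarrow> X l \<omega> = X l \<omega>'"
      have "?D i \<omega> = ?D i \<omega>'" by (rule D_path) (use ij * in auto)
      moreover have "?W j \<omega> = ?W j \<omega>'" by (rule weighted_occupation_path) (rule *)
      ultimately show "Z z \<omega> = Z z \<omega>'" by (simp add: Z_def)
    qed
    moreover have "\<bar>Z z \<omega>\<bar> \<le> 2 * B * B" for z \<omega>
      unfolding Z_def abs_mult using B D_bound G_bound[OF W] by (intro mult_mono) auto
    ultimately have Z\<Delta>: "integrable M (\<lambda>\<omega>. Z z \<omega> * \<Delta> z \<omega>)" "expectation (\<lambda>\<omega>. Z z \<omega> * \<Delta> z \<omega>) = 0" for z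
      unfolding \<Delta>_def using ij
      by (auto intro!: vrrw_increment_orthogonal[OF walk a_pos U_pos, of j "Z z" "2 * B * B" z])
    \<comment> \<open>Expanding over the value \<open>z\<close> of \<open>X\<^sub>j\<^sub>+\<^sub>1\<close> turns the increment into a combination of centred indicators
      with coefficients known at time \<open>j\<close>.\<close>
    have "?D j \<omega> = (\<Sum>z\<in>UNIV. G (?W j \<omega>) $ z $ y * \<Delta> z \<omega>)" for \<omega>
    proof -
      have "G (?W j \<omega>) $ X (Suc j) \<omega> $ y
          = (\<Sum>z\<in>UNIV. G (?W j \<omega>) $ z $ y * of_bool (X (Suc j) \<omega> = z))"
        by simp
      then show ?thesis
        using ij by (simp add: poisson_martingale_increment_def \<Delta>_def right_diff_distrib sum_subtractf mult.commute)
    qed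
    then have "?D i \<omega> * ?D j \<omega> = (\<Sum>z\<in>UNIV. Z z \<omega> * \<Delta> z \<omega>)" for \<omega>
      by (simp add: Z_def sum_distrib_left mult.assoc)
    then show ?thesis using Z\<Delta> by (simp add: Bochner_Integration.integral_sum)
  qed
  show ?thesis
    by (rule bounded_orthogonal_slln[OF D_meas D_bound orth])
qed

lemma uniformly_close_images:
  fixes g :: "'a::metric_space \<Rightarrow> 'b::real_normed_vector"
  assumes "compact S" "continuous_on S g" "\<And>n. x n \<in> S" "\<And>n. y n \<in> S"
    and "(\<lambda>n. dist (x n) (y n)) \<longlonglongrightarrow> 0"
  shows "(\<lambda>n. g (x n) - g (y n)) \<longlonglongrightarrow> 0"
  using compact_uniformly_continuous[OF assms(2,1)] assms(3-5)
  unfolding uniformly_continuous_on_sequentially dist_norm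
  by (auto intro: tendsto_norm_zero_cancel)

text \<open>Fix a path. By the Poisson equation, \<open>1(X\<^sub>i\<^sub>+\<^sub>1 = y) - \<pi>(v\<^sub>i)(y)\<close> is the martingale increment, plus
  \<open>Q\<^sub>i(X\<^sub>i) - Q\<^sub>i\<^sub>+\<^sub>1(X\<^sub>i\<^sub>+\<^sub>1)\<close> with \<open>Q\<^sub>i = K(w\<^sub>i) g\<^sub>i\<close>, plus a remainder \<open>r\<^sub>i\<close> that collects the changes from \<open>w\<^sub>i\<close>
  to \<open>w\<^sub>i\<^sub>+\<^sub>1\<close> in \<open>Q\<close> and from \<open>w\<^sub>i\<close> to \<open>v\<^sub>i\<close> in \<open>\<pi>\<close>. Both changes vanish by uniform continuity on the simplex.\<close>

lemma occupation_averages_invariant: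
  fixes U :: "real ^ 'e::finite ^ 'e" and X :: "nat \<Rightarrow> 'w \<Rightarrow> 'e"
  assumes a_pos: "\<And>n. n \<ge> 1 \<Longrightarrow> a n > 0" and U_pos: "\<forall>x y. U $ x $ y > 0"
    and weights: "(\<lambda>n. \<Sum>i=1..n. \<bar>a i / (\<Sum>j=1..n. a j) - 1 / real n\<bar>) \<longlonglongrightarrow> 0"
    and G_cont: "\<And>x y. continuous_on prob_vecs (\<lambda>v. G v $ x $ y)"
    and poisson: "\<And>v x y. v \<in> prob_vecs \<Longrightarrow>
       G v $ x $ y - (\<Sum>z\<in>UNIV. limit_kernel U v $ x $ z * G v $ z $ y)
         = of_bool (x = y) - limit_invariant U v $ y"
    and \<pi>_cont: "continuous_on prob_vecs (limit_invariant U)"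
    and slln: "(\<lambda>n. (\<Sum>i<n. poisson_martingale_increment U a X G y i \<omega>) / real n) \<longlonglongrightarrow> 0"
  shows "(\<lambda>n. (occupation X n \<omega>
      - (1 / real n) *\<^sub>R (\<Sum>i=1..<n. limit_invariant U (occupation X i \<omega>))) $ y) \<longlonglongrightarrow> 0"
proof -
  let ?W = "\<lambda>n. weighted_occupation a X n \<omega>" and ?v = "\<lambda>n. occupation X n \<omega>"
    and ?x = "\<lambda>n. X n \<omega>" and ?D = "\<lambda>n. poisson_martingale_increment U a X G y n \<omega>"
  define Q where "Q v x = (\<Sum>z\<in>UNIV. limit_kernel U v $ x $ z * G v $ z $ y)" for v x
  have W: "?W n \<in> prob_vecs" for n by (rule weighted_occupation_in_prob_vecs[OF a_pos])
  have Q_cont: "continuous_on prob_vecs (\<lambda>v. Q v x)" for x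
    unfolding Q_def by (intro continuous_intros continuous_on_limit_kernel U_pos G_cont)
  have close: "(\<lambda>n. ?W n - ?v n) \<longlonglongrightarrow> 0" by (rule weighted_occupation_close[OF a_pos weights])
  have step_W: "(\<lambda>n. ?W (Suc n) - ?W n) \<longlonglongrightarrow> 0"
  proof -
    have "eventually (\<lambda>n. norm (?v (Suc n) - ?v n) \<le> 2 / real (Suc n)) sequentially"
    proof (rule eventually_sequentiallyI[of 1])
      fix n :: nat assume "1 \<le> n"
      then show "norm (?v (Suc n) - ?v n) \<le> 2 / real (Suc n)"
        using occupation_slow[of n "Suc n" X \<omega>] by simp
    qed
    moreover have "(\<lambda>n. 2 / real (Suc n)) \<longlonglongrightarrow> 0"
      by (rule LIMSEQ_Suc[OF lim_const_over_n])
    ultimately have "(\<lambda>n. ?v (Suc n) - ?v n) \<longlonglongrightarrow> 0" by (rule Lim_null_comparison)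
    from tendsto_diff[OF tendsto_add[OF LIMSEQ_Suc[OF close] this] close]
    show ?thesis by simp
  qed
  define r where "r i = (if i = 0 then 0 else
      (Q (?W (Suc i)) (?x (Suc i)) - Q (?W i) (?x (Suc i)))
      + (limit_invariant U (?W i) $ y - limit_invariant U (?v i) $ y))" for i
  have r0: "r \<longlonglongrightarrow> 0"
  proof -
    have "(\<lambda>i. \<Sum>x\<in>UNIV. \<bar>Q (?W (Suc i)) x - Q (?W i) x\<bar>) \<longlonglongrightarrow> (\<Sum>x\<in>(UNIV :: 'e set). 0)"
    proof (intro tendsto_sum tendsto_rabs_zero)
      show "(\<lambda>i. Q (?W (Suc i)) x - Q (?W i) x) \<longlonglongrightarrow> 0" for x
        using step_W by (intro uniformly_close_images[OF compact_prob_vecs Q_cont] W)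
          (simp add: dist_norm tendsto_norm_zero)
    qed
    then have "(\<lambda>i. \<Sum>x\<in>UNIV. \<bar>Q (?W (Suc i)) x - Q (?W i) x\<bar>) \<longlonglongrightarrow> 0" by simp
    moreover have "norm (Q (?W (Suc i)) (?x (Suc i)) - Q (?W i) (?x (Suc i)))
        \<le> (\<Sum>x\<in>UNIV. \<bar>Q (?W (Suc i)) x - Q (?W i) x\<bar>)" for i
      unfolding real_norm_def by (intro member_le_sum) auto
    ultimately have 1: "(\<lambda>i. Q (?W (Suc i)) (?x (Suc i)) - Q (?W i) (?x (Suc i))) \<longlonglongrightarrow> 0"
      by (rule Lim_null_comparison[OF always_eventually, OF allI, rotated])
    have "(\<lambda>i. limit_invariant U (?W (Suc i)) - limit_invariant U (?v (Suc i))) \<longlonglongrightarrow> 0"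
      using LIMSEQ_Suc[OF close]
      by (intro uniformly_close_images[OF compact_prob_vecs \<pi>_cont] W occupation_in_prob_vecs)
        (simp_all add: dist_norm tendsto_norm_zero)
    then have "(\<lambda>i. limit_invariant U (?W i) - limit_invariant U (?v i)) \<longlonglongrightarrow> 0"
      by (rule LIMSEQ_imp_Suc)
    from tendsto_vec_nth[OF this, of y]
    have 2: "(\<lambda>i. limit_invariant U (?W i) $ y - limit_invariant U (?v i) $ y) \<longlonglongrightarrow> 0" by simp
    have "eventually (\<lambda>i. (Q (?W (Suc i)) (?x (Suc i)) - Q (?W i) (?x (Suc i)))
        + (limit_invariant U (?W i) $ y - limit_invariant U (?v i) $ y) = r i) sequentially"
      by (intro eventually_sequentiallyI[of 1]) (simp add: r_def)
    with tendsto_add[OF 1 2] show ?thesis by (auto elim: Lim_transform_eventually)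
  qed
  \<comment> \<open>The Poisson equation at time \<open>i\<close>, rearranged so that the potential telescopes.\<close>
  have decomp: "of_bool (?x (Suc i) = y) - limit_invariant U (?v i) $ y
      = ?D i + r i + (Q (?W i) (?x i) - Q (?W (Suc i)) (?x (Suc i)))" if "i \<ge> 1" for i
    using poisson[OF W, of i "?x (Suc i)" y] that
    by (simp add: poisson_martingale_increment_def r_def Q_def)
  have D0: "?D 0 = 0" and r_0: "r 0 = 0" by (simp_all add: poisson_martingale_increment_def r_def)
  have identity: "(\<Sum>i=1..n. of_bool (?x i = y)) - (\<Sum>i=1..<n. limit_invariant U (?v i) $ y)
      = (\<Sum>i<n. ?D i) + (\<Sum>i<n. r i) + (of_bool (?x 1 = y) + Q (?W 1) (?x 1) - Q (?W n) (?x n))"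
    if "n \<ge> 1" for n
    using that
  proof (induction n rule: dec_induct)
    case base
    then show ?case by (simp add: D0 r_0)
  next
    case (step n)
    then show ?case using decomp[of n] by simp
  qed
  obtain B where B: "\<And>n x. \<bar>Q (?W n) x\<bar> \<le> B"
  proof -
    have "\<exists>b. \<forall>v\<in>prob_vecs. \<bar>Q v x\<bar> \<le> b" for x
      using compact_imp_bounded[OF compact_continuous_image[OF Q_cont compact_prob_vecs], of x]
      by (auto simp: bounded_iff)
    then obtain b where b: "\<And>x v. v \<in> prob_vecs \<Longrightarrow> \<bar>Q v x\<bar> \<le> b x" by metis
    have "\<bar>Q (?W n) x\<bar> \<le> (\<Sum>x\<in>UNIV. \<bar>b x\<bar>)" for n x
    proof -
      have "\<bar>Q (?W n) x\<bar> \<le> \<bar>b x\<bar>" using b[OF W, of n x] by linarith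
      also have "\<dots> \<le> (\<Sum>x\<in>UNIV. \<bar>b x\<bar>)" by (intro member_le_sum) auto
      finally show ?thesis .
    qed
    then show thesis by (rule that)
  qed
  have boundary: "(\<lambda>n. (of_bool (?x 1 = y) + Q (?W 1) (?x 1) - Q (?W n) (?x n)) / real n) \<longlonglongrightarrow> 0"
  proof (rule Lim_null_comparison[OF always_eventually, OF allI])
    fix n
    have "\<bar>of_bool (?x 1 = y) + Q (?W 1) (?x 1) - Q (?W n) (?x n)\<bar> \<le> 1 + 2 * B"
      using B[of 1 "?x 1"] B[of n "?x n"] by (cases "?x 1 = y") auto
    then show "norm ((of_bool (?x 1 = y) + Q (?W 1) (?x 1) - Q (?W n) (?x n)) / real n)
        \<le> (1 + 2 * B) / real n"
      by (simp add: divide_right_mono)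
  qed (rule lim_const_over_n)
  have "(\<lambda>n. (\<Sum>i<n. r i) / real n) \<longlonglongrightarrow> 0"
    using cesaro_null[OF r0] by simp
  from tendsto_add[OF tendsto_add[OF slln this] boundary]
  have "(\<lambda>n. (\<Sum>i<n. ?D i) / real n + (\<Sum>i<n. r i) / real n
      + (of_bool (?x 1 = y) + Q (?W 1) (?x 1) - Q (?W n) (?x n)) / real n) \<longlonglongrightarrow> 0" by simp
  moreover have "eventually (\<lambda>n. (\<Sum>i<n. ?D i) / real n + (\<Sum>i<n. r i) / real n
      + (of_bool (?x 1 = y) + Q (?W 1) (?x 1) - Q (?W n) (?x n)) / real n
      = (?v n - (1 / real n) *\<^sub>R (\<Sum>i=1..<n. limit_invariant U (?v i))) $ y) sequentially"
  proof (intro eventually_sequentiallyI[of 1])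
    fix n :: nat assume "n \<ge> 1"
    have "(?v n - (1 / real n) *\<^sub>R (\<Sum>i=1..<n. limit_invariant U (?v i))) $ y
        = ((\<Sum>i=1..n. of_bool (?x i = y)) - (\<Sum>i=1..<n. limit_invariant U (?v i) $ y)) / real n"
      by (simp add: occupation_nth diff_divide_distrib del: sum_of_bool_eq)
    then show "(\<Sum>i<n. ?D i) / real n + (\<Sum>i<n. r i) / real n
      + (of_bool (?x 1 = y) + Q (?W 1) (?x 1) - Q (?W n) (?x n)) / real n
      = (?v n - (1 / real n) *\<^sub>R (\<Sum>i=1..<n. limit_invariant U (?v i))) $ y"
      by (simp only: identity[OF \<open>n \<ge> 1\<close>] add_divide_distrib)
  qed
  ultimately show ?thesis by (rule Lim_transform_eventually)
qed


section \<open>Limit sets of averaged recursions\<close>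

lemma limit_set_iff_frequently_near:
  fixes v :: "nat \<Rightarrow> 'a::metric_space"
  shows "p \<in> limit_set v \<longleftrightarrow> (\<forall>\<epsilon>>0. \<forall>N. \<exists>n\<ge>N. dist (v n) p < \<epsilon>)"
proof
  assume "p \<in> limit_set v"
  then obtain k where k: "filterlim k at_top sequentially" "(\<lambda>j. v (k j)) \<longlonglongrightarrow> p"
    by (auto simp: limit_set_def)
  show "\<forall>\<epsilon>>0. \<forall>N. \<exists>n\<ge>N. dist (v n) p < \<epsilon>"
  proof (intro allI impI)
    fix \<epsilon> :: real and N :: nat assume "\<epsilon> > 0"
    then have "eventually (\<lambda>j. dist (v (k j)) p < \<epsilon>) sequentially" by (rule tendstoD[OF k(2)])
    moreover have "eventually (\<lambda>j. k j \<ge> N) sequentially"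
      using k(1) by (simp add: filterlim_at_top)
    ultimately have "eventually (\<lambda>j. k j \<ge> N \<and> dist (v (k j)) p < \<epsilon>) sequentially"
      by eventually_elim simp
    then show "\<exists>n\<ge>N. dist (v n) p < \<epsilon>" by (auto simp: eventually_sequentially)
  qed
next
  assume near: "\<forall>\<epsilon>>0. \<forall>N. \<exists>n\<ge>N. dist (v n) p < \<epsilon>"
  have "\<forall>j. \<exists>n\<ge>j. dist (v n) p < inverse (real (Suc j))"
    using near by simp
  then obtain k where k: "\<And>j. k j \<ge> j" "\<And>j. dist (v (k j)) p < inverse (real (Suc j))"
    by metis
  have "filterlim k at_top sequentially"
    using k(1) by (intro filterlim_at_top_mono[OF filterlim_ident]) auto
  moreover have "(\<lambda>j. v (k j)) \<longlonglongrightarrow> p"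
    by (rule metric_tendsto_imp_tendsto[OF LIMSEQ_inverse_real_of_nat])
      (use k(2) in \<open>auto intro!: always_eventually simp: less_imp_le\<close>)
  ultimately show "p \<in> limit_set v" by (auto simp: limit_set_def)
qed

lemma compact_limit_set:
  fixes v :: "nat \<Rightarrow> 'a::metric_space"
  assumes "compact D" and "\<And>n. n \<ge> 1 \<Longrightarrow> v n \<in> D"
  shows "limit_set v \<subseteq> D" "compact (limit_set v)"
proof -
  show sub: "limit_set v \<subseteq> D"
  proof
    fix p assume "p \<in> limit_set v"
    then obtain k where k: "filterlim k at_top sequentially" "(\<lambda>j. v (k j)) \<longlonglongrightarrow> p"
      by (auto simp: limit_set_def)
    have "eventually (\<lambda>j. k j \<ge> 1) sequentially" using k(1) by (simp add: filterlim_at_top)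
    then have "eventually (\<lambda>j. v (k j) \<in> D) sequentially" by eventually_elim (rule assms(2))
    then show "p \<in> D"
      using Lim_in_closed_set[OF compact_imp_closed[OF assms(1)] _ _ k(2)] by simp
  qed
  have "p \<in> limit_set v" if p: "p \<in> closure (limit_set v)" for p
    unfolding limit_set_iff_frequently_near
  proof (intro allI impI)
    fix \<epsilon> :: real and N :: nat assume "\<epsilon> > 0"
    then obtain q where q: "q \<in> limit_set v" "dist q p < \<epsilon> / 2"
      using p by (auto simp: closure_approachable dest: spec[of _ "\<epsilon> / 2"])
    then obtain n where "n \<ge> N" "dist (v n) q < \<epsilon> / 2"
      using \<open>\<epsilon> > 0\<close> unfolding limit_set_iff_frequently_near by (meson half_gt_zero)
    with q show "\<exists>n\<ge>N. dist (v n) p < \<epsilon>"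
      using dist_triangle_half_r[of q "v n" \<epsilon> p] by (auto simp: dist_commute intro!: exI[of _ n] dist_triangle_half_l)
  qed
  then have "closed (limit_set v)" by (metis closure_subset closure_eq subsetI subset_antisym)
  then show "compact (limit_set v)"
    using compact_Int_closed[OF assms(1)] sub by (metis inf.absorb2)
qed

lemma lipschitz_imp_abs_continuous_on:
  assumes "\<And>s t. s \<le> t \<Longrightarrow> norm (f t - f s) \<le> C * (t - s)"
  shows "abs_continuous_on S f"
  unfolding abs_continuous_on_def
proof (intro allI impI)
  fix \<epsilon> :: real assume "\<epsilon> > 0"
  have C: "C \<ge> 0" using order_trans[OF norm_ge_zero assms[of 0 1]] by simp
  show "\<exists>\<delta>>0. \<forall>(n::nat) l u. (\<forall>i<n. l i \<le> u i \<and> {l i..u i} \<subseteq> S) \<and>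
        (\<forall>i<n. \<forall>j<n. i \<noteq> j \<longrightarrow> {l i<..<u i} \<inter> {l j<..<u j} = {}) \<and>
        (\<Sum>i<n. u i - l i) < \<delta> \<longrightarrow> (\<Sum>i<n. norm (f (u i) - f (l i))) < \<epsilon>"
  proof (intro exI conjI allI impI)
    show "\<epsilon> / (C + 1) > 0" using \<open>\<epsilon> > 0\<close> C by simp
    fix n :: nat and l u
    assume *: "(\<forall>i<n. l i \<le> u i \<and> {l i..u i} \<subseteq> S) \<and>
        (\<forall>i<n. \<forall>j<n. i \<noteq> j \<longrightarrow> {l i<..<u i} \<inter> {l j<..<u j} = {}) \<and>
        (\<Sum>i<n. u i - l i) < \<epsilon> / (C + 1)"
    have "(\<Sum>i<n. norm (f (u i) - f (l i))) \<le> (\<Sum>i<n. C * (u i - l i))"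
      using * assms by (intro sum_mono) auto
    also have "\<dots> \<le> (C + 1) * (\<Sum>i<n. u i - l i)"
      using * by (auto simp: sum_distrib_left[symmetric] intro!: mult_right_mono sum_nonneg)
    also have "\<dots> < \<epsilon>" using * C by (simp add: pos_less_divide_eq mult.commute)
    finally show "(\<Sum>i<n. norm (f (u i) - f (l i))) < \<epsilon>" .
  qed
qed

lemma floor_scaling:
  fixes N :: "nat \<Rightarrow> real"
  assumes N: "filterlim N at_top sequentially" and y: "y > 0"
  shows "filterlim (\<lambda>j. nat \<lfloor>N j * y\<rfloor>) at_top sequentially"
    and "(\<lambda>j. real (nat \<lfloor>N j * y\<rfloor>) / N j) \<longlonglongrightarrow> y"
proof -
  have Ny: "filterlim (\<lambda>j. N j * y) at_top sequentially"
    by (rule filterlim_at_top_mult_tendsto_pos[OF tendsto_const y N])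
  then show "filterlim (\<lambda>j. nat \<lfloor>N j * y\<rfloor>) at_top sequentially"
    by (intro filterlim_compose[OF filterlim_nat_sequentially]
        filterlim_compose[OF filterlim_floor_sequentially])
  have pos: "eventually (\<lambda>j. N j > 0) sequentially" using N by (simp add: filterlim_at_top_dense)
  have inv: "(\<lambda>j. y - 1 / N j) \<longlonglongrightarrow> y - 0"
    by (intro tendsto_intros real_tendsto_divide_at_top[OF tendsto_const N])
  show "(\<lambda>j. real (nat \<lfloor>N j * y\<rfloor>) / N j) \<longlonglongrightarrow> y"
  proof (rule tendsto_sandwich[OF _ _ _ tendsto_const])
    show "(\<lambda>j. y - 1 / N j) \<longlonglongrightarrow> y" using inv by simp
    show "eventually (\<lambda>j. y - 1 / N j \<le> real (nat \<lfloor>N j * y\<rfloor>) / N j) sequentially"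
      using pos
    proof eventually_elim
      case (elim j)
      have "N j * y - 1 \<le> real (nat \<lfloor>N j * y\<rfloor>)" by linarith
      then have "(N j * y - 1) / N j \<le> real (nat \<lfloor>N j * y\<rfloor>) / N j"
        using elim by (intro divide_right_mono) auto
      then show ?case using elim by (simp add: diff_divide_distrib)
    qed
    show "eventually (\<lambda>j. real (nat \<lfloor>N j * y\<rfloor>) / N j \<le> y) sequentially"
      using pos
    proof eventually_elim
      case (elim j)
      then have "N j * y \<ge> 0" using y by simp
      then have "real (nat \<lfloor>N j * y\<rfloor>) \<le> N j * y" by simp
      then show ?case using elim by (simp add: pos_divide_le_eq mult.commute)
    qed
  qed
qed

text \<open>The deterministic situation to which the walk is reduced: a sequence that varies slowly in
  logarithmic time and is asymptotically the running average of \<open>f\<close> along itself.\<close>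

locale averaged_recursion =
  fixes v :: "nat \<Rightarrow> 'a::euclidean_space" and f :: "'a \<Rightarrow> 'a" and D :: "'a set" and C :: real
  assumes D: "compact D" and v_in: "\<And>n. n \<ge> 1 \<Longrightarrow> v n \<in> D"
    and slow: "\<And>m n. 1 \<le> m \<Longrightarrow> m \<le> n \<Longrightarrow> norm (v n - v m) \<le> C * (real n - real m) / real n"
    and cont: "continuous_on D f"
    and average: "(\<lambda>n. v n - (1 / real n) *\<^sub>R (\<Sum>i=1..<n. f (v i))) \<longlonglongrightarrow> 0"
begin

lemma C_nonneg: "C \<ge> 0"
proof -
  have "0 \<le> C * (real 2 - real 1) / real 2"
    using order_trans[OF norm_ge_zero slow[of 1 2]] by simp
  then show ?thesis by simp
qed

lemma slow_sym:
  assumes "1 \<le> m" "1 \<le> n"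
  shows "norm (v n - v m) \<le> C * \<bar>real n - real m\<bar> / real m"
proof (cases "m \<le> n")
  case True
  then have "C * (real n - real m) / real n \<le> C * (real n - real m) / real m"
    using assms C_nonneg by (intro divide_left_mono) auto
  then show ?thesis using slow[OF assms(1) True] True by simp
next
  case False
  then show ?thesis using slow[of n m] assms by (simp add: norm_minus_commute)
qed

text \<open>The factor \<open>r j\<close> may vary with \<open>j\<close>, since the compactness argument for shadowing compares pieces
  of varying length.\<close>

lemma index_shift:
  fixes N :: "nat \<Rightarrow> real"
  assumes N: "filterlim N at_top sequentially" and x: "x > 0" and y: "y > 0" "r \<longlonglongrightarrow> y"
  shows "(\<lambda>j. C * \<bar>real (nat \<lfloor>N j * r j\<rfloor>) - real (nat \<lfloor>N j * x\<rfloor>)\<bar> / real (nat \<lfloor>N j * x\<rfloor>))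
      \<longlonglongrightarrow> C * \<bar>y - x\<bar> / x"
    and "eventually (\<lambda>j. norm (v (nat \<lfloor>N j * r j\<rfloor>) - v (nat \<lfloor>N j * x\<rfloor>))
      \<le> C * \<bar>real (nat \<lfloor>N j * r j\<rfloor>) - real (nat \<lfloor>N j * x\<rfloor>)\<bar> / real (nat \<lfloor>N j * x\<rfloor>)) sequentially"
proof -
  have pos: "eventually (\<lambda>j. N j > 0) sequentially" using N by (simp add: filterlim_at_top_dense)
  have ry: "eventually (\<lambda>j. r j > y / 2) sequentially"
    using order_tendstoD(1)[OF y(2), of "y / 2"] y(1) by simp
  have Nr: "filterlim (\<lambda>j. N j * r j) at_top sequentially"
    by (rule filterlim_tendsto_pos_mult_at_top[OF y(2,1) N, simplified mult.commute])
  have n_lim: "(\<lambda>j. real (nat \<lfloor>N j * r j\<rfloor>) / N j) \<longlonglongrightarrow> y"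
  proof -
    have *: "(\<lambda>j. real (nat \<lfloor>(N j * r j) * 1\<rfloor>) / (N j * r j)) \<longlonglongrightarrow> 1"
      by (rule floor_scaling(2)[OF Nr]) simp
    have "(\<lambda>j. real (nat \<lfloor>(N j * r j) * 1\<rfloor>) / (N j * r j) * r j) \<longlonglongrightarrow> 1 * y"
      by (rule tendsto_mult[OF * y(2)])
    moreover have "eventually (\<lambda>j. real (nat \<lfloor>(N j * r j) * 1\<rfloor>) / (N j * r j) * r j
        = real (nat \<lfloor>N j * r j\<rfloor>) / N j) sequentially"
      using ry by eventually_elim (use y(1) in simp)
    ultimately show ?thesis by (auto elim: Lim_transform_eventually)
  qed
  have m_lim: "(\<lambda>j. real (nat \<lfloor>N j * x\<rfloor>) / N j) \<longlonglongrightarrow> x"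
    by (rule floor_scaling(2)[OF N x])
  have "(\<lambda>j. C * \<bar>real (nat \<lfloor>N j * r j\<rfloor>) / N j - real (nat \<lfloor>N j * x\<rfloor>) / N j\<bar>
      / (real (nat \<lfloor>N j * x\<rfloor>) / N j)) \<longlonglongrightarrow> C * \<bar>y - x\<bar> / x"
    by (intro tendsto_intros n_lim m_lim) (use x in simp)
  moreover have "eventually (\<lambda>j. C * \<bar>real (nat \<lfloor>N j * r j\<rfloor>) / N j - real (nat \<lfloor>N j * x\<rfloor>) / N j\<bar>
      / (real (nat \<lfloor>N j * x\<rfloor>) / N j)
      = C * \<bar>real (nat \<lfloor>N j * r j\<rfloor>) - real (nat \<lfloor>N j * x\<rfloor>)\<bar> / real (nat \<lfloor>N j * x\<rfloor>)) sequentially"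
    using pos by eventually_elim (simp flip: diff_divide_distrib)
  ultimately show "(\<lambda>j. C * \<bar>real (nat \<lfloor>N j * r j\<rfloor>) - real (nat \<lfloor>N j * x\<rfloor>)\<bar> / real (nat \<lfloor>N j * x\<rfloor>))
      \<longlonglongrightarrow> C * \<bar>y - x\<bar> / x"
    by (rule Lim_transform_eventually)
  have "eventually (\<lambda>j. nat \<lfloor>N j * r j\<rfloor> \<ge> 1) sequentially"
    using floor_scaling(1)[OF Nr, of 1] by (simp add: filterlim_at_top)
  moreover have "eventually (\<lambda>j. nat \<lfloor>N j * x\<rfloor> \<ge> 1) sequentially"
    using floor_scaling(1)[OF N x] by (simp add: filterlim_at_top)
  ultimately show "eventually (\<lambda>j. norm (v (nat \<lfloor>N j * r j\<rfloor>) - v (nat \<lfloor>N j * x\<rfloor>))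
      \<le> C * \<bar>real (nat \<lfloor>N j * r j\<rfloor>) - real (nat \<lfloor>N j * x\<rfloor>)\<bar> / real (nat \<lfloor>N j * x\<rfloor>)) sequentially"
    by eventually_elim (rule slow_sym)
qed

text \<open>A diagonal argument gives convergence at rational arguments. Slow variation, in the form of
  \<open>index_shift\<close>, carries it over to all positive ones.\<close>

lemma rescaled_subsequence:
  fixes N :: "nat \<Rightarrow> real"
  assumes N: "filterlim N at_top sequentially"
  obtains k \<zeta> where "strict_mono (k :: nat \<Rightarrow> nat)"
    "\<And>y. y > 0 \<Longrightarrow> (\<lambda>j. v (nat \<lfloor>N (k j) * y\<rfloor>)) \<longlonglongrightarrow> \<zeta> y"
proof -
  obtain B where B: "\<And>u. u \<in> D \<Longrightarrow> norm u \<le> B"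
    using compact_imp_bounded[OF D] by (auto simp: bounded_iff)
  have v_bound: "norm (v n) \<le> max B (norm (v 0))" for n
    using B[OF v_in[of n]] by (cases "n = 0") auto
  obtain k where k: "strict_mono (k :: nat \<Rightarrow> nat)"
    and conv_rat: "\<And>q. q \<in> \<rat> \<Longrightarrow> \<exists>l. (\<lambda>j. v (nat \<lfloor>N (k j) * q\<rfloor>)) \<longlonglongrightarrow> l"
    using function_convergent_subsequence[OF countable_rat, of "\<lambda>j q. v (nat \<lfloor>N j * q\<rfloor>)"
        "max B (norm (v 0))"] v_bound by metis
  have Nk: "filterlim (\<lambda>j. N (k j)) at_top sequentially"
    by (rule filterlim_compose[OF N filterlim_subseq[OF k]])
  have "convergent (\<lambda>j. v (nat \<lfloor>N (k j) * y\<rfloor>))" if y: "y > 0" for y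
  proof (intro Cauchy_convergent metric_CauchyI)
    fix \<epsilon> :: real assume \<epsilon>: "\<epsilon> > 0"
    \<comment> \<open>By \<open>index_shift\<close>, moving from \<open>y\<close> to \<open>q\<close> costs \<open>C (q - y) / y\<close> in the limit, to be made less than \<open>\<epsilon> / 3\<close>.\<close>
    have "y < y + y * \<epsilon> / (3 * (C + 1))" using y \<epsilon> C_nonneg by simp
    then obtain q where q: "q \<in> \<rat>" "y < q" "q < y + y * \<epsilon> / (3 * (C + 1))"
      using Rats_dense_in_real by blast
    have "q > 0" using q y by simp
    have "C * \<bar>q - y\<bar> / y < \<epsilon> / 3"
    proof -
      have "C * \<bar>q - y\<bar> \<le> (C + 1) * (q - y)" using q by (simp add: mult_right_mono)
      also have "\<dots> < (C + 1) * (y * \<epsilon> / (3 * (C + 1)))"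
        using q C_nonneg by (intro mult_strict_left_mono) auto
      also have "\<dots> = \<epsilon> / 3 * y" using C_nonneg by (simp add: field_simps)
      finally show ?thesis using y by (simp add: pos_divide_less_eq)
    qed
    from order_tendstoD(2)[OF index_shift(1)[OF Nk y \<open>q > 0\<close> tendsto_const] this]
      index_shift(2)[OF Nk y \<open>q > 0\<close> tendsto_const]
    have "eventually (\<lambda>j. norm (v (nat \<lfloor>N (k j) * q\<rfloor>) - v (nat \<lfloor>N (k j) * y\<rfloor>)) < \<epsilon> / 3) sequentially"
      by eventually_elim linarith
    then obtain J1 where J1: "\<And>j. j \<ge> J1 \<Longrightarrow>
        dist (v (nat \<lfloor>N (k j) * q\<rfloor>)) (v (nat \<lfloor>N (k j) * y\<rfloor>)) < \<epsilon> / 3"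
      by (auto simp: eventually_sequentially dist_norm)
    have q_Cauchy: "Cauchy (\<lambda>j. v (nat \<lfloor>N (k j) * q\<rfloor>))"
      using conv_rat[OF q(1)] by (auto intro: LIMSEQ_imp_Cauchy)
    then obtain J2 where J2: "\<And>i j. i \<ge> J2 \<Longrightarrow> j \<ge> J2 \<Longrightarrow>
        dist (v (nat \<lfloor>N (k i) * q\<rfloor>)) (v (nat \<lfloor>N (k j) * q\<rfloor>)) < \<epsilon> / 3"
      using metric_CauchyD[OF q_Cauchy, of "\<epsilon> / 3"] \<epsilon> by auto
    show "\<exists>M. \<forall>i\<ge>M. \<forall>j\<ge>M. dist (v (nat \<lfloor>N (k i) * y\<rfloor>)) (v (nat \<lfloor>N (k j) * y\<rfloor>)) < \<epsilon>"
    proof (intro exI allI impI)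
      fix i j assume "i \<ge> max J1 J2" "j \<ge> max J1 J2"
      then show "dist (v (nat \<lfloor>N (k i) * y\<rfloor>)) (v (nat \<lfloor>N (k j) * y\<rfloor>)) < \<epsilon>"
        using J1[of i] J1[of j] J2[of i j]
          dist_triangle3[of "v (nat \<lfloor>N (k i) * y\<rfloor>)" "v (nat \<lfloor>N (k j) * q\<rfloor>)" "v (nat \<lfloor>N (k i) * q\<rfloor>)"]
          dist_triangle[of "v (nat \<lfloor>N (k i) * y\<rfloor>)" "v (nat \<lfloor>N (k j) * y\<rfloor>)" "v (nat \<lfloor>N (k j) * q\<rfloor>)"]
        by simp
    qed
  qed
  then have "\<exists>\<zeta>. \<forall>y>0. (\<lambda>j. v (nat \<lfloor>N (k j) * y\<rfloor>)) \<longlonglongrightarrow> \<zeta> y"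
    unfolding convergent_def by metis
  with k that show thesis by blast
qed

lemma limit_set_subset: "limit_set v \<subseteq> D" and compact_limit_set_v: "compact (limit_set v)"
  by (rule compact_limit_set[OF D]; erule v_in)+

context
  fixes N :: "nat \<Rightarrow> real" and \<zeta> :: "real \<Rightarrow> 'a"
  assumes N: "filterlim N at_top sequentially"
    and \<zeta>: "\<And>y. y > 0 \<Longrightarrow> (\<lambda>j. v (nat \<lfloor>N j * y\<rfloor>)) \<longlonglongrightarrow> \<zeta> y"
begin

lemma rescaled_limit_in_limit_set: "y > 0 \<Longrightarrow> \<zeta> y \<in> limit_set v"
  using floor_scaling(1)[OF N] \<zeta> by (auto simp: limit_set_def)

lemma rescaled_limit_in: "y > 0 \<Longrightarrow> \<zeta> y \<in> D"
  using rescaled_limit_in_limit_set limit_set_subset by blast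

lemma rescaled_limit_lipschitz:
  assumes "x > 0" "y > 0"
  shows "norm (\<zeta> y - \<zeta> x) \<le> C * \<bar>y - x\<bar> / x"
  by (rule tendsto_le[OF sequentially_bot index_shift(1)[OF N assms tendsto_const]
        tendsto_norm[OF tendsto_diff[OF \<zeta> \<zeta>]] index_shift(2)[OF N assms tendsto_const]])
    (use assms in auto)

text \<open>With \<open>n = \<lfloor>N y\<rfloor>\<close> and \<open>m = \<lfloor>N x\<rfloor>\<close>, the averaging relation says that \<open>n v\<^sub>n - m v\<^sub>m\<close> is the sum of \<open>f(v\<^sub>i)\<close> over
  \<open>m \<le> i < n\<close> up to \<open>o(N)\<close>. If \<open>x\<close> and \<open>y\<close> are close, all these \<open>v\<^sub>i\<close> are near \<open>\<zeta>(p)\<close>. Dividing by \<open>N\<close> and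
  letting \<open>N\<close> grow gives the bound directly, without forming an integral of \<open>f(\<zeta>)\<close>.\<close>

lemma rescaled_increment:
  assumes x: "0 < x" "x \<le> p" "p \<le> y"
    and osc: "\<And>u. u \<in> D \<Longrightarrow> norm (u - \<zeta> p) < \<eta> \<Longrightarrow> norm (f u - f (\<zeta> p)) \<le> \<epsilon>"
    and small: "C * \<bar>y - x\<bar> / x < \<eta> / 2"
  shows "norm (y *\<^sub>R \<zeta> y - x *\<^sub>R \<zeta> x - (y - x) *\<^sub>R f (\<zeta> p)) \<le> \<epsilon> * (y - x)"
proof -
  have p: "p > 0" and y: "y > 0" using x by auto
  define S where "S n = (\<Sum>i=1..<n. f (v i))" for n
  define e where "e n = v n - (1 / real n) *\<^sub>R S n" for n
  have e0: "e \<longlonglongrightarrow> 0" using average by (simp add: e_def[abs_def] S_def)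
  define n where "n j = nat \<lfloor>N j * y\<rfloor>" for j
  define m where "m j = nat \<lfloor>N j * x\<rfloor>" for j
  define q where "q j = nat \<lfloor>N j * p\<rfloor>" for j
  have \<eta>: "\<eta> > 0"
  proof -
    have "0 \<le> C * \<bar>y - x\<bar> / x" using C_nonneg x by simp
    with small show ?thesis by linarith
  qed
  have n_top: "filterlim n at_top sequentially" and m_top: "filterlim m at_top sequentially"
    unfolding n_def[abs_def] m_def[abs_def] using floor_scaling(1)[OF N] x(1) y by auto
  have n_lim: "(\<lambda>j. real (n j) / N j) \<longlonglongrightarrow> y" and m_lim: "(\<lambda>j. real (m j) / N j) \<longlonglongrightarrow> x"
    unfolding n_def m_def using floor_scaling(2)[OF N] x(1) y by auto
  have ev_pos: "eventually (\<lambda>j. N j > 0) sequentially" using N by (simp add: filterlim_at_top_dense)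
  have ev_m: "eventually (\<lambda>j. m j \<ge> 1) sequentially" using m_top by (simp add: filterlim_at_top)
  have ev_small: "eventually (\<lambda>j. C * \<bar>real (n j) - real (m j)\<bar> / real (m j) < \<eta> / 2) sequentially"
    unfolding n_def m_def
    by (rule order_tendstoD(2)[OF index_shift(1)[OF N x(1) y tendsto_const] small])
  have ev_q: "eventually (\<lambda>j. dist (v (q j)) (\<zeta> p) < \<eta> / 2) sequentially"
    unfolding q_def using \<zeta>[OF p] \<eta> by (intro tendstoD) auto
  have "eventually (\<lambda>j.
      norm ((real (n j) / N j) *\<^sub>R v (n j) - (real (m j) / N j) *\<^sub>R v (m j)
        - (real (n j) / N j - real (m j) / N j) *\<^sub>R f (\<zeta> p))
      \<le> \<epsilon> * (real (n j) / N j - real (m j) / N j)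
        + ((real (n j) / N j) * norm (e (n j)) + (real (m j) / N j) * norm (e (m j)))) sequentially"
    using ev_pos ev_m ev_small ev_q
  proof eventually_elim
    case (elim j)
    have mq: "m j \<le> q j" and qn: "q j \<le> n j"
      unfolding m_def q_def n_def using x elim
      by (auto intro!: nat_mono floor_mono mult_left_mono)
    have close: "norm (f (v i) - f (\<zeta> p)) \<le> \<epsilon>" if i: "i \<in> {m j..<n j}" for i
    proof (rule osc)
      show "v i \<in> D" using i elim by (intro v_in) auto
      have "norm (v i - v (q j)) \<le> C * \<bar>real i - real (q j)\<bar> / real (q j)"
        using i elim mq by (intro slow_sym) auto
      also have "\<dots> \<le> C * \<bar>real (n j) - real (m j)\<bar> / real (m j)"
        using i elim mq qn C_nonneg by (intro frac_le mult_left_mono mult_nonneg_nonneg) auto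
      finally have "norm (v i - v (q j)) < \<eta> / 2" using elim by linarith
      then show "norm (v i - \<zeta> p) < \<eta>"
        using elim norm_triangle_ineq[of "v i - v (q j)" "v (q j) - \<zeta> p"] by (simp add: dist_norm)
    qed
    have split: "S (n j) = S (m j) + (\<Sum>i=m j..<n j. f (v i))"
      unfolding S_def using elim mq qn by (subst sum.atLeastLessThan_concat) auto
    have ve: "real k *\<^sub>R v k = S k + real k *\<^sub>R e k" if "k \<ge> 1" for k
      using that by (simp add: e_def scaleR_diff_right)
    have "real (n j) *\<^sub>R v (n j) - real (m j) *\<^sub>R v (m j) - (real (n j) - real (m j)) *\<^sub>R f (\<zeta> p)
        = (\<Sum>i=m j..<n j. f (v i) - f (\<zeta> p)) + (real (n j) *\<^sub>R e (n j) - real (m j) *\<^sub>R e (m j))"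
      using elim mq qn
      by (simp add: ve split sum_subtractf sum_constant_scaleR of_nat_diff)
    also have "norm \<dots> \<le> (\<Sum>i=m j..<n j. \<epsilon>) + (real (n j) * norm (e (n j)) + real (m j) * norm (e (m j)))"
    proof (intro norm_triangle_mono)
      show "norm (\<Sum>i=m j..<n j. f (v i) - f (\<zeta> p)) \<le> (\<Sum>i=m j..<n j. \<epsilon>)"
        by (intro sum_norm_le close)
      show "norm (real (n j) *\<^sub>R e (n j) - real (m j) *\<^sub>R e (m j))
          \<le> real (n j) * norm (e (n j)) + real (m j) * norm (e (m j))"
        by (rule order_trans[OF norm_triangle_ineq4]) simp
    qed
    also have "(\<Sum>i=m j..<n j. \<epsilon>) = \<epsilon> * (real (n j) - real (m j))"
      using mq qn by (simp add: of_nat_diff)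
    finally have bound: "norm (real (n j) *\<^sub>R v (n j) - real (m j) *\<^sub>R v (m j)
          - (real (n j) - real (m j)) *\<^sub>R f (\<zeta> p))
        \<le> \<epsilon> * (real (n j) - real (m j)) + (real (n j) * norm (e (n j)) + real (m j) * norm (e (m j)))"
      (is "norm ?w \<le> ?b") .
    have "(real (n j) / N j) *\<^sub>R v (n j) - (real (m j) / N j) *\<^sub>R v (m j)
        - (real (n j) / N j - real (m j) / N j) *\<^sub>R f (\<zeta> p) = (1 / N j) *\<^sub>R ?w"
      by (simp add: scaleR_diff_right scaleR_diff_left)
    also have "norm \<dots> = (1 / N j) * norm ?w" using elim by simp
    also have "\<dots> \<le> (1 / N j) * ?b" using bound elim by (intro mult_left_mono) auto
    also have "\<dots> = \<epsilon> * (real (n j) / N j - real (m j) / N j)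
        + ((real (n j) / N j) * norm (e (n j)) + (real (m j) / N j) * norm (e (m j)))"
      by (simp add: add_divide_distrib diff_divide_distrib right_diff_distrib)
    finally show ?case .
  qed
  moreover have "(\<lambda>j. norm ((real (n j) / N j) *\<^sub>R v (n j) - (real (m j) / N j) *\<^sub>R v (m j)
        - (real (n j) / N j - real (m j) / N j) *\<^sub>R f (\<zeta> p)))
      \<longlonglongrightarrow> norm (y *\<^sub>R \<zeta> y - x *\<^sub>R \<zeta> x - (y - x) *\<^sub>R f (\<zeta> p))"
    using \<zeta>[OF y] \<zeta>[OF x(1)]
    by (intro tendsto_intros n_lim m_lim) (simp_all add: n_def m_def)
  moreover have "(\<lambda>j. \<epsilon> * (real (n j) / N j - real (m j) / N j)
        + ((real (n j) / N j) * norm (e (n j)) + (real (m j) / N j) * norm (e (m j))))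
      \<longlonglongrightarrow> \<epsilon> * (y - x) + (y * norm (0::'a) + x * norm (0::'a))"
    by (intro tendsto_intros n_lim m_lim filterlim_compose[OF e0 n_top] filterlim_compose[OF e0 m_top])
  ultimately show ?thesis
    using tendsto_le[OF sequentially_bot] by fastforce
qed

lemma rescaled_limit_derivative:
  assumes p: "p > 0"
  shows "((\<lambda>y. y *\<^sub>R \<zeta> y) has_vector_derivative f (\<zeta> p)) (at p)"
  unfolding has_vector_derivative_def has_derivative_at_alt
proof (intro conjI allI impI)
  show "bounded_linear (\<lambda>x. x *\<^sub>R f (\<zeta> p))" by (rule bounded_linear_scaleR_left)
  fix \<epsilon> :: real assume \<epsilon>: "\<epsilon> > 0"
  obtain \<eta> where \<eta>: "\<eta> > 0"
    and osc: "\<And>u. u \<in> D \<Longrightarrow> norm (u - \<zeta> p) < \<eta> \<Longrightarrow> norm (f u - f (\<zeta> p)) \<le> \<epsilon>"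
    using cont[unfolded continuous_on_iff, rule_format, OF rescaled_limit_in[OF p] \<epsilon>]
    by (auto simp: dist_norm less_imp_le)
  define \<delta> where "\<delta> = min (p / 2) (\<eta> * p / (4 * (C + 1)))"
  have \<delta>: "\<delta> > 0" using p \<eta> C_nonneg by (simp add: \<delta>_def)
  have small: "C * \<bar>y - x\<bar> / x < \<eta> / 2" if xy: "\<bar>y - x\<bar> < \<delta>" "\<bar>x - p\<bar> < \<delta>" for x y
  proof -
    have "\<bar>x - p\<bar> < p / 2" using xy(2) by (simp add: \<delta>_def)
    then have x: "x > p / 2" by linarith
    have "C * \<bar>y - x\<bar> \<le> C * \<delta>" using xy C_nonneg by (intro mult_left_mono) auto
    also have "\<dots> < (C + 1) * \<delta>" using \<delta> by simp
    also have "\<dots> \<le> (C + 1) * (\<eta> * p / (4 * (C + 1)))"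
      using C_nonneg by (intro mult_left_mono) (auto simp: \<delta>_def)
    also have "\<dots> = (\<eta> / 2) * (p / 2)" using C_nonneg by (simp add: field_simps)
    also have "\<dots> < (\<eta> / 2) * x" using x \<eta> by (intro mult_strict_left_mono) auto
    finally show ?thesis using x p by (simp add: pos_divide_less_eq)
  qed
  show "\<exists>d>0. \<forall>y. norm (y - p) < d \<longrightarrow>
      norm (y *\<^sub>R \<zeta> y - p *\<^sub>R \<zeta> p - (y - p) *\<^sub>R f (\<zeta> p)) \<le> \<epsilon> * norm (y - p)"
  proof (intro exI conjI allI impI)
    fix y assume y: "norm (y - p) < \<delta>"
    then have "\<bar>y - p\<bar> < p / 2" by (simp add: \<delta>_def)
    then have y_pos: "y > 0" using p by linarith
    show "norm (y *\<^sub>R \<zeta> y - p *\<^sub>R \<zeta> p - (y - p) *\<^sub>R f (\<zeta> p)) \<le> \<epsilon> * norm (y - p)"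
    proof (cases "p \<le> y")
      case True
      then show ?thesis
        using rescaled_increment[of p p y \<eta> \<epsilon>] p y \<delta> osc small[of y p] by simp
    next
      case False
      have "norm (p *\<^sub>R \<zeta> p - y *\<^sub>R \<zeta> y - (p - y) *\<^sub>R f (\<zeta> p)) \<le> \<epsilon> * (p - y)"
        using False y y_pos osc small[of p y]
        by (intro rescaled_increment) (auto simp: abs_minus_commute)
      moreover have "y *\<^sub>R \<zeta> y - p *\<^sub>R \<zeta> p - (y - p) *\<^sub>R f (\<zeta> p)
          = - (p *\<^sub>R \<zeta> p - y *\<^sub>R \<zeta> y - (p - y) *\<^sub>R f (\<zeta> p))"
        by (simp add: algebra_simps)
      moreover have "norm (y - p) = p - y" using False by simp
      ultimately show ?thesis by (simp only: norm_minus_cancel)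
    qed
  qed (rule \<delta>)
qed

text \<open>From \<open>(y \<zeta>(y))' = f(\<zeta>(y))\<close> the equation for \<open>\<zeta>(e\<^sup>t) = e\<^sup>-\<^sup>t (e\<^sup>t \<zeta>(e\<^sup>t))\<close> follows by the product rule.\<close>

lemma rescaled_limit_solution:
  "ode_solution (\<lambda>u. - u + f u) D (\<lambda>t. \<zeta> (exp t))"
  unfolding ode_solution_def
proof (intro conjI allI)
  show "\<zeta> (exp t) \<in> D" for t by (simp add: rescaled_limit_in)
  show "abs_continuous_on {s..t} (\<lambda>t. \<zeta> (exp t))" for s t
  proof (rule lipschitz_imp_abs_continuous_on)
    fix s t :: real assume "s \<le> t"
    have "norm (\<zeta> (exp t) - \<zeta> (exp s)) = norm (\<zeta> (exp s) - \<zeta> (exp t))"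
      by (rule norm_minus_commute)
    also have "\<dots> \<le> C * \<bar>exp s - exp t\<bar> / exp t"
      by (rule rescaled_limit_lipschitz) auto
    also have "\<dots> = C * (1 - exp (s - t))"
      using \<open>s \<le> t\<close> by (simp add: field_simps exp_diff)
    also have "\<dots> \<le> C * (t - s)"
    proof (rule mult_left_mono[OF _ C_nonneg])
      show "1 - exp (s - t) \<le> t - s" using exp_ge_add_one_self[of "s - t"] by linarith
    qed
    finally show "norm (\<zeta> (exp t) - \<zeta> (exp s)) \<le> C * (t - s)" .
  qed
  show "AE t in lborel. ((\<lambda>t. \<zeta> (exp t)) has_vector_derivative - \<zeta> (exp t) + f (\<zeta> (exp t))) (at t)"
  proof (intro AE_I2)
    fix t :: real
    have "((\<lambda>y. y *\<^sub>R \<zeta> y) \<circ> exp has_vector_derivative exp t *\<^sub>R f (\<zeta> (exp t))) (at t)"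
      by (intro vector_diff_chain_at rescaled_limit_derivative)
        (auto intro!: derivative_eq_intros simp: has_real_derivative_iff_has_vector_derivative[symmetric])
    then have "((\<lambda>t. exp (- t) *\<^sub>R ((\<lambda>y. y *\<^sub>R \<zeta> y) \<circ> exp) t) has_vector_derivative
        exp (- t) *\<^sub>R (exp t *\<^sub>R f (\<zeta> (exp t))) + (- exp (- t)) *\<^sub>R ((\<lambda>y. y *\<^sub>R \<zeta> y) \<circ> exp) t) (at t)"
      by (rule has_vector_derivative_scaleR[rotated]) (auto intro!: derivative_eq_intros)
    moreover have "exp (- t) *\<^sub>R ((\<lambda>y. y *\<^sub>R \<zeta> y) \<circ> exp) t = \<zeta> (exp t)" for t
      by (simp flip: exp_add)
    moreover have "exp (- t) *\<^sub>R (exp t *\<^sub>R f (\<zeta> (exp t))) + (- exp (- t)) *\<^sub>R ((\<lambda>y. y *\<^sub>R \<zeta> y) \<circ> exp) t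
        = - \<zeta> (exp t) + f (\<zeta> (exp t))"
      by (simp flip: exp_add)
    ultimately show "((\<lambda>t. \<zeta> (exp t)) has_vector_derivative - \<zeta> (exp t) + f (\<zeta> (exp t))) (at t)"
      by simp
  qed
qed

end

text \<open>Otherwise there are scales \<open>N\<^sub>j \<rightarrow> \<infinity>\<close> and lengths \<open>\<tau>\<^sub>j\<close> without a shadowing solution. Along a subsequence
  \<open>\<tau>\<^sub>j\<close> converges and the rescaled sequences converge to a solution, which then shadows after all.
  Only the two ends of a piece matter for chains.\<close>

lemma shadowing:
  assumes \<epsilon>: "\<epsilon> > 0" and T: "T > 0"
  shows "\<exists>N0. \<forall>N\<ge>N0. \<forall>\<tau>\<in>{T..2 * T}. \<exists>z.
      ode_solution (\<lambda>u. - u + f u) D z \<and> range z \<subseteq> limit_set v \<and>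
      norm (z 0 - v (nat \<lfloor>N\<rfloor>)) \<le> \<epsilon> \<and> norm (z \<tau> - v (nat \<lfloor>N * exp \<tau>\<rfloor>)) \<le> \<epsilon>"
proof (rule ccontr)
  define good where "good N \<tau> z \<longleftrightarrow> ode_solution (\<lambda>u. - u + f u) D z \<and> range z \<subseteq> limit_set v \<and>
      norm (z 0 - v (nat \<lfloor>N\<rfloor>)) \<le> \<epsilon> \<and> norm (z \<tau> - v (nat \<lfloor>N * exp \<tau>\<rfloor>)) \<le> \<epsilon>" for N \<tau> z
  assume "\<not> ?thesis"
  then have "\<forall>N0. \<exists>N\<ge>N0. \<exists>\<tau>\<in>{T..2 * T}. \<forall>z. \<not> good N \<tau> z" by (auto simp: good_def not_le)
  then have "\<forall>j::nat. \<exists>N \<tau>. N \<ge> real j \<and> \<tau> \<in> {T..2 * T} \<and> (\<forall>z. \<not> good N \<tau> z)" by meson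
  then obtain N \<tau> where N\<tau>: "\<And>j. N j \<ge> real j" "\<And>j. \<tau> j \<in> {T..2 * T}"
      "\<And>j z. \<not> good (N j) (\<tau> j) z"
    by metis
  have N_top: "filterlim N at_top sequentially"
    by (rule filterlim_at_top_mono[OF filterlim_real_sequentially]) (simp add: N\<tau>(1))
  obtain r \<tau>0 where r: "strict_mono (r :: nat \<Rightarrow> nat)" and \<tau>0: "(\<tau> \<circ> r) \<longlonglongrightarrow> \<tau>0"
    using compact_Icc[of T "2 * T"] N\<tau>(2) unfolding compact_eq_seq_compact_metric seq_compact_def by metis
  have Nr: "filterlim (N \<circ> r) at_top sequentially"
    using filterlim_compose[OF N_top filterlim_subseq[OF r]] by (simp add: o_def)
  obtain k \<zeta> where k: "strict_mono (k :: nat \<Rightarrow> nat)"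
    and \<zeta>: "\<And>y. y > 0 \<Longrightarrow> (\<lambda>j. v (nat \<lfloor>(N \<circ> r) (k j) * y\<rfloor>)) \<longlonglongrightarrow> \<zeta> y"
    using rescaled_subsequence[OF Nr] by blast
  define N' where "N' = N \<circ> r \<circ> k"
  define \<tau>' where "\<tau>' = \<tau> \<circ> r \<circ> k"
  have N': "filterlim N' at_top sequentially"
    using filterlim_compose[OF Nr filterlim_subseq[OF k]] by (simp add: N'_def o_def)
  have \<tau>': "\<tau>' \<longlonglongrightarrow> \<tau>0"
    using LIMSEQ_subseq_LIMSEQ[OF \<tau>0 k] by (simp add: \<tau>'_def)
  have \<zeta>': "(\<lambda>j. v (nat \<lfloor>N' j * y\<rfloor>)) \<longlonglongrightarrow> \<zeta> y" if "y > 0" for y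
    using \<zeta>[OF that] by (simp add: N'_def)
  define z where "z t = \<zeta> (exp t)" for t
  have sol: "ode_solution (\<lambda>u. - u + f u) D z"
    unfolding z_def[abs_def] by (rule rescaled_limit_solution[OF N' \<zeta>'])
  have range_z: "range z \<subseteq> limit_set v"
    unfolding z_def[abs_def] using rescaled_limit_in_limit_set[OF N' \<zeta>'] by auto
  have start: "(\<lambda>j. z 0 - v (nat \<lfloor>N' j\<rfloor>)) \<longlonglongrightarrow> 0"
    using tendsto_diff[OF tendsto_const \<zeta>'[of 1], of "z 0"] by (simp add: z_def)
  have end_lim: "(\<lambda>j. z (\<tau>' j) - v (nat \<lfloor>N' j * exp (\<tau>' j)\<rfloor>)) \<longlonglongrightarrow> 0"
  proof -
    have exp_\<tau>: "(\<lambda>j. exp (\<tau>' j)) \<longlonglongrightarrow> exp \<tau>0" by (intro tendsto_intros \<tau>')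
    have "(\<lambda>j. C * \<bar>exp (\<tau>' j) - exp \<tau>0\<bar> / exp \<tau>0) \<longlonglongrightarrow> C * \<bar>exp \<tau>0 - exp \<tau>0\<bar> / exp \<tau>0"
      by (intro tendsto_intros exp_\<tau>) simp
    then have "(\<lambda>j. C * \<bar>exp (\<tau>' j) - exp \<tau>0\<bar> / exp \<tau>0) \<longlonglongrightarrow> 0" by simp
    then have 1: "(\<lambda>j. z (\<tau>' j) - z \<tau>0) \<longlonglongrightarrow> 0"
      by (rule Lim_null_comparison[rotated])
        (auto simp: z_def intro!: always_eventually rescaled_limit_lipschitz[OF N' \<zeta>'])
    have "(\<lambda>j. C * \<bar>real (nat \<lfloor>N' j * exp (\<tau>' j)\<rfloor>) - real (nat \<lfloor>N' j * exp \<tau>0\<rfloor>)\<bar>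
        / real (nat \<lfloor>N' j * exp \<tau>0\<rfloor>)) \<longlonglongrightarrow> 0"
      using index_shift(1)[OF N' _ _ exp_\<tau>, of "exp \<tau>0"] by simp
    then have 2: "(\<lambda>j. v (nat \<lfloor>N' j * exp (\<tau>' j)\<rfloor>) - v (nat \<lfloor>N' j * exp \<tau>0\<rfloor>)) \<longlonglongrightarrow> 0"
      by (rule Lim_null_comparison[rotated]) (rule index_shift(2)[OF N' _ _ exp_\<tau>]; simp)
    have 3: "(\<lambda>j. z \<tau>0 - v (nat \<lfloor>N' j * exp \<tau>0\<rfloor>)) \<longlonglongrightarrow> 0"
      using tendsto_diff[OF tendsto_const \<zeta>'[of "exp \<tau>0"], of "z \<tau>0"] by (simp add: z_def)
    show ?thesis using tendsto_diff[OF tendsto_add[OF 1 3] 2] by simp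
  qed
  have "eventually (\<lambda>j. norm (z 0 - v (nat \<lfloor>N' j\<rfloor>)) < \<epsilon>) sequentially"
    using order_tendstoD(2)[OF tendsto_norm_zero[OF start] \<epsilon>] .
  moreover have "eventually (\<lambda>j. norm (z (\<tau>' j) - v (nat \<lfloor>N' j * exp (\<tau>' j)\<rfloor>)) < \<epsilon>) sequentially"
    using order_tendstoD(2)[OF tendsto_norm_zero[OF end_lim] \<epsilon>] .
  ultimately have "eventually (\<lambda>j. good (N' j) (\<tau>' j) z) sequentially"
    by eventually_elim (use sol range_z in \<open>auto simp: good_def\<close>)
  then show False
    using N\<tau>(3) by (auto simp: N'_def \<tau>'_def eventually_sequentially)
qed

text \<open>Let the sequence be near \<open>x\<close> at a late time \<open>a\<close> and near \<open>y\<close> at a much later time \<open>b\<close>. The logarithmic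
  distance \<open>s = ln (b/a)\<close> is at least \<open>T'\<close>, so it splits into \<open>n\<close> equal pieces of length between \<open>T'\<close> and \<open>2 T'\<close>.
  Shadowing each piece within \<open>\<epsilon>/2\<close> makes consecutive solutions match within \<open>\<epsilon>\<close>.\<close>

theorem limit_set_internally_chain_transitive:
  "internally_chain_transitive (\<lambda>u. - u + f u) D (limit_set v)"
  unfolding internally_chain_transitive_def
proof (intro conjI ballI)
  show "limit_set v \<subseteq> D" "compact (limit_set v)"
    by (rule limit_set_subset, rule compact_limit_set_v)
  fix x y assume x: "x \<in> limit_set v" and y: "y \<in> limit_set v"
  show "chain_connected (\<lambda>u. - u + f u) D (limit_set v) x y"
    unfolding chain_connected_def
  proof (intro allI impI)
    fix \<epsilon> T :: real assume \<epsilon>: "\<epsilon> > 0" and T: "T > 0"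
    define T' where "T' = T + 1"
    have T': "T' > 0" "T' > T" using T by (auto simp: T'_def)
    obtain N0 where N0: "\<And>N \<tau>. N \<ge> N0 \<Longrightarrow> \<tau> \<in> {T'..2 * T'} \<Longrightarrow> \<exists>z.
        ode_solution (\<lambda>u. - u + f u) D z \<and> range z \<subseteq> limit_set v \<and>
        norm (z 0 - v (nat \<lfloor>N\<rfloor>)) \<le> \<epsilon> / 2 \<and> norm (z \<tau> - v (nat \<lfloor>N * exp \<tau>\<rfloor>)) \<le> \<epsilon> / 2"
      using shadowing[of "\<epsilon> / 2" T'] \<epsilon> T' by (auto simp: Ball_def)
    obtain a where a: "a \<ge> max 1 (nat \<lceil>N0\<rceil>)" "dist (v a) x < \<epsilon> / 2"
      using x \<epsilon> unfolding limit_set_iff_frequently_near by (meson half_gt_zero)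
    have a_pos: "real a > 0" and a_N0: "real a \<ge> N0" using a(1) by linarith+
    obtain b where b: "b \<ge> nat \<lceil>real a * exp T'\<rceil>" "dist (v b) y < \<epsilon> / 2"
      using y \<epsilon> unfolding limit_set_iff_frequently_near by (meson half_gt_zero)
    have ab: "real a * exp T' \<le> real b" using b(1) by linarith
    have b_pos: "real b > 0" using ab a_pos by (smt (verit) exp_gt_zero mult_pos_pos)
    define s where "s = ln (real b / real a)"
    have exp_s: "exp s = real b / real a" using a_pos b_pos by (simp add: s_def)
    have "exp T' \<le> exp s" unfolding exp_s using ab a_pos by (simp add: pos_le_divide_eq mult.commute)
    then have s: "T' \<le> s" by simp
    define n where "n = nat \<lfloor>s / T'\<rfloor>"
    have "1 \<le> s / T'" using s T' by simp
    then have n: "n \<ge> 1" "real n \<le> s / T'" "s / T' < real n + 1"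
      unfolding n_def by linarith+
    define \<tau> where "\<tau> = s / real n"
    have \<tau>: "\<tau> \<in> {T'..2 * T'}"
    proof -
      have "real n * T' \<le> s" using n T' by (simp add: pos_le_divide_eq)
      moreover have "s \<le> real n * (2 * T')"
      proof -
        have "s < (real n + 1) * T'" using n T' by (simp add: pos_divide_less_eq)
        also have "\<dots> \<le> (2 * real n) * T'" using n T' by (intro mult_right_mono) auto
        finally show ?thesis by simp
      qed
      ultimately show ?thesis using n by (simp add: \<tau>_def field_simps)
    qed
    \<comment> \<open>The cutting points, starting with \<open>P 1 = a\<close> and ending exactly at \<open>P (n+1) = b\<close>.\<close>
    define P where "P i = real a * exp ((real i - 1) * \<tau>)" for i :: nat
    have P_step: "P (Suc i) = P i * exp \<tau>" for i
      by (simp add: P_def algebra_simps flip: exp_add)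
    have P1: "P 1 = real a" by (simp add: P_def)
    have P_end: "P (Suc n) = real b"
      using n a_pos by (simp add: P_def \<tau>_def exp_s)
    have "\<exists>z. ode_solution (\<lambda>u. - u + f u) D z \<and> range z \<subseteq> limit_set v \<and>
        norm (z 0 - v (nat \<lfloor>P i\<rfloor>)) \<le> \<epsilon> / 2 \<and> norm (z \<tau> - v (nat \<lfloor>P (Suc i)\<rfloor>)) \<le> \<epsilon> / 2"
      if "i \<ge> 1" for i
    proof -
      have "0 \<le> (real i - 1) * \<tau>" using that \<tau> T' by auto
      then have "1 \<le> exp ((real i - 1) * \<tau>)" by simp
      then have "real a * 1 \<le> P i" unfolding P_def using a_pos by (intro mult_left_mono) auto
      then show ?thesis unfolding P_step using a_N0 \<tau> by (intro N0) auto
    qed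
    then obtain z where z: "\<And>i. i \<ge> 1 \<Longrightarrow> ode_solution (\<lambda>u. - u + f u) D (z i) \<and>
        range (z i) \<subseteq> limit_set v \<and> norm (z i 0 - v (nat \<lfloor>P i\<rfloor>)) \<le> \<epsilon> / 2 \<and>
        norm (z i \<tau> - v (nat \<lfloor>P (Suc i)\<rfloor>)) \<le> \<epsilon> / 2"
      by metis
    show "\<exists>(n::nat) \<xi> t. n \<ge> 1 \<and>
        (\<forall>i\<in>{1..n}. ode_solution (\<lambda>u. - u + f u) D (\<xi> i) \<and> t i > T \<and> \<xi> i ` {0..t i} \<subseteq> limit_set v) \<and>
        (\<forall>i\<in>{1..<n}. norm (\<xi> i (t i) - \<xi> (Suc i) 0) \<le> \<epsilon>) \<and>
        norm (\<xi> 1 0 - x) \<le> \<epsilon> \<and> norm (\<xi> n (t n) - y) \<le> \<epsilon>"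
    proof (intro exI conjI ballI)
      show "n \<ge> 1" by fact
      fix i assume i: "i \<in> {1..n}"
      show "ode_solution (\<lambda>u. - u + f u) D (z i)" using z[of i] i by simp
      show "\<tau> > T" using \<tau> T' by simp
      show "z i ` {0..\<tau>} \<subseteq> limit_set v" using z[of i] i by auto
    next
      fix i assume i: "i \<in> {1..<n}"
      have "norm (z i \<tau> - v (nat \<lfloor>P (Suc i)\<rfloor>)) \<le> \<epsilon> / 2"
          "norm (z (Suc i) 0 - v (nat \<lfloor>P (Suc i)\<rfloor>)) \<le> \<epsilon> / 2"
        using z[of i] z[of "Suc i"] i by auto
      then show "norm (z i \<tau> - z (Suc i) 0) \<le> \<epsilon>"
        using norm_triangle_ineq4[of "z i \<tau> - v (nat \<lfloor>P (Suc i)\<rfloor>)" "z (Suc i) 0 - v (nat \<lfloor>P (Suc i)\<rfloor>)"]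
        by simp
    next
      have "norm (z 1 0 - v a) \<le> \<epsilon> / 2" using z[of 1] unfolding P1 by simp
      then show "norm (z 1 0 - x) \<le> \<epsilon>"
        using norm_triangle_ineq[of "z 1 0 - v a" "v a - x"] a(2) by (simp add: dist_norm)
      have "norm (z n \<tau> - v b) \<le> \<epsilon> / 2" using z[OF n(1)] unfolding P_end by simp
      then show "norm (z n \<tau> - y) \<le> \<epsilon>"
        using norm_triangle_ineq[of "z n \<tau> - v b" "v b - y"] b(2) by (simp add: dist_norm)
    qed
  qed
qed

end

section \<open>The limit set of the reinforced walk\<close>

theorem theorem4p9:
  fixes M :: "'w measure"
    and U :: "real ^ 'e::finite ^ 'e"
    and a :: "nat \<Rightarrow> real"
    and X :: "nat \<Rightarrow> 'w \<Rightarrow> 'e"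
  assumes U_pos: "\<forall>x y. U $ x $ y > 0"
    and a_pos: "\<forall>n\<ge>1. a n > 0"
    and ratio: "(\<lambda>n. (\<Sum>i=1..Suc n. a i) / (\<Sum>i=1..n. a i)) \<longlonglongrightarrow> 1"
    and walk: "vrrw M U a X"
    and cases:
      "(\<exists>\<alpha>::real \<Rightarrow> real.
          (\<forall>t>0. \<alpha> t > 0) \<and> (\<forall>i\<ge>1. a i = \<alpha> (real i)) \<and>
          mono_on {0<..} \<alpha> \<and> continuous_on {0<..} \<alpha> \<and>
          (\<forall>s\<in>{0<..1}. ((\<lambda>t. \<alpha> (t * s) / \<alpha> t) \<longlongrightarrow> 1) at_top))
       \<or>
       (\<exists>\<alpha>::real \<Rightarrow> real.
          (\<forall>t>0. \<alpha> t > 0) \<and> (\<forall>i\<ge>1. a i = \<alpha> (real i)) \<and>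
          antimono_on {0<..} \<alpha> \<and> continuous_on {0<..} \<alpha> \<and>
          (\<forall>s\<in>{0<..1}. ((\<lambda>t. \<alpha> (t * s) / \<alpha> t) \<longlongrightarrow> 1) at_top) \<and>
          (\<exists>b::real \<Rightarrow> real.
             (\<forall>s\<in>{0..1}. 0 \<le> b s) \<and>
             set_borel_measurable lebesgue {0..1} b \<and>
             (\<integral>\<^sup>+s\<in>{0..1}. ennreal (b s) \<partial>lebesgue) < \<infinity> \<and>
             (\<forall>s\<in>{0<..1}. \<forall>t>0. 0 \<le> \<alpha> (t * s) / \<alpha> t - 1 \<and> \<alpha> (t * s) / \<alpha> t - 1 \<le> b s)))"
  shows "AE \<omega> in M.
           internally_chain_transitive (\<lambda>v. - v + limit_invariant U v) prob_vecs
             (limit_set (\<lambda>n. occupation X n \<omega>))"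
proof -
  have a: "a n > 0" if "n \<ge> 1" for n using a_pos that by blast
  have "(\<lambda>n. (1 / real n) * (\<Sum>i=1..n. \<bar>a i / a n - 1\<bar>)) \<longlonglongrightarrow> 0"
    using cases
  proof (elim disjE exE conjE)
    fix \<alpha> :: "real \<Rightarrow> real"
    assume \<alpha>: "\<forall>t>0. \<alpha> t > 0" "\<forall>i\<ge>1. a i = \<alpha> (real i)" "mono_on {0<..} \<alpha>"
      "\<forall>s\<in>{0<..1}. ((\<lambda>t. \<alpha> (t * s) / \<alpha> t) \<longlongrightarrow> 1) at_top"
    have "(\<lambda>n. (1 / real n) * (\<Sum>i=1..n. \<bar>\<alpha> (real i) / \<alpha> (real n) - 1\<bar>)) \<longlonglongrightarrow> 0"
      by (rule nondecreasing_weights) (use \<alpha> in auto)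
    then show ?thesis using \<alpha>(2) by simp
  next
    fix \<alpha> b :: "real \<Rightarrow> real"
    assume \<alpha>: "\<forall>t>0. \<alpha> t > 0" "\<forall>i\<ge>1. a i = \<alpha> (real i)" "antimono_on {0<..} \<alpha>"
      "\<forall>s\<in>{0<..1}. ((\<lambda>t. \<alpha> (t * s) / \<alpha> t) \<longlongrightarrow> 1) at_top"
      and b: "\<forall>s\<in>{0..1}. 0 \<le> b s" "set_borel_measurable lebesgue {0..1} b"
        "(\<integral>\<^sup>+s\<in>{0..1}. ennreal (b s) \<partial>lebesgue) < \<infinity>"
        "\<forall>s\<in>{0<..1}. \<forall>t>0. 0 \<le> \<alpha> (t * s) / \<alpha> t - 1 \<and> \<alpha> (t * s) / \<alpha> t - 1 \<le> b s"
    have "(\<lambda>n. (1 / real n) * (\<Sum>i=1..n. \<bar>\<alpha> (real i) / \<alpha> (real n) - 1\<bar>)) \<longlonglongrightarrow> 0"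
      by (rule nonincreasing_weights[OF _ \<alpha>(3) _ _ b(2,3)]) (use \<alpha> b in auto)
    then show ?thesis using \<alpha>(2) by simp
  qed
  then have weights: "(\<lambda>n. \<Sum>i=1..n. \<bar>a i / (\<Sum>j=1..n. a j) - 1 / real n\<bar>) \<longlonglongrightarrow> 0"
    by (rule self_normalized_weights[rotated]) (rule a)
  obtain G :: "real ^ 'e \<Rightarrow> real ^ 'e ^ 'e" where
    G_cont: "\<And>x y. continuous_on prob_vecs (\<lambda>v. G v $ x $ y)" and
    poisson: "\<And>v x y. v \<in> prob_vecs \<Longrightarrow>
       G v $ x $ y - (\<Sum>z\<in>UNIV. limit_kernel U v $ x $ z * G v $ z $ y)
         = of_bool (x = y) - limit_invariant U v $ y" and
    \<pi>_cont: "continuous_on prob_vecs (limit_invariant U)"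
  proof (rule poisson_equation_family[OF U_pos])
    fix G :: "real ^ 'e \<Rightarrow> real ^ 'e ^ 'e"
    assume "\<And>x y. continuous_on prob_vecs (\<lambda>v. G v $ x $ y)"
      and "\<And>v x y. v \<in> prob_vecs \<Longrightarrow>
        G v $ x $ y - (\<Sum>z\<in>UNIV. limit_kernel U v $ x $ z * G v $ z $ y)
          = of_bool (x = y) - limit_invariant U v $ y"
      and "continuous_on prob_vecs (limit_invariant U)"
    then show thesis by (rule that)
  qed
  obtain B where B: "\<And>v x y. v \<in> prob_vecs \<Longrightarrow> \<bar>G v $ x $ y\<bar> \<le> B"
  proof -
    have "\<exists>b. \<forall>v\<in>prob_vecs. \<bar>G v $ x $ y\<bar> \<le> b" for x y
      using compact_imp_bounded[OF compact_continuous_image[OF G_cont compact_prob_vecs], of x y]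
      by (auto simp: bounded_iff)
    then obtain b where b: "\<And>x y v. v \<in> prob_vecs \<Longrightarrow> \<bar>G v $ x $ y\<bar> \<le> b x y" by metis
    have "\<bar>G v $ x $ y\<bar> \<le> (\<Sum>(x, y)\<in>UNIV. \<bar>b x y\<bar>)" if "v \<in> prob_vecs" for v x y
    proof -
      have "\<bar>G v $ x $ y\<bar> \<le> \<bar>b x y\<bar>" using b[OF that, of x y] by linarith
      also have "\<dots> \<le> (\<Sum>(x, y)\<in>UNIV. \<bar>b x y\<bar>)"
        using member_le_sum[of "(x, y)" UNIV "\<lambda>(x, y). \<bar>b x y\<bar>"] by auto
      finally show ?thesis .
    qed
    then show thesis by (rule that)
  qed
  have "AE \<omega> in M. \<forall>y. (\<lambda>n. (\<Sum>i<n. poisson_martingale_increment U a X G y i \<omega>) / real n) \<longlonglongrightarrow> 0"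
    unfolding AE_all_countable
    by (intro allI poisson_martingale_increment_slln[OF walk a U_pos B])
  then show ?thesis
  proof eventually_elim
    case (elim \<omega>)
    have "(\<lambda>n. occupation X n \<omega>
        - (1 / real n) *\<^sub>R (\<Sum>i=1..<n. limit_invariant U (occupation X i \<omega>))) \<longlonglongrightarrow> 0"
    proof (rule vec_tendstoI)
      fix y
      show "(\<lambda>n. (occupation X n \<omega>
          - (1 / real n) *\<^sub>R (\<Sum>i=1..<n. limit_invariant U (occupation X i \<omega>))) $ y) \<longlonglongrightarrow> (0 :: real ^ 'e) $ y"
        using occupation_averages_invariant[OF a U_pos weights G_cont poisson \<pi>_cont, of X y \<omega>] elim
        by simp
    qed
    then interpret averaged_recursion "\<lambda>n. occupation X n \<omega>" "limit_invariant U" prob_vecs 2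
      by unfold_locales
        ((rule compact_prob_vecs occupation_in_prob_vecs occupation_slow \<pi>_cont; assumption) | assumption)+
    show ?case by (rule limit_set_internally_chain_transitive)
  qed
qed

end
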